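(* Let $A,B\in H_6$ be two operators with non-degenerate eigenspaces (i.e., each has six distinct eigenvalues on $\mathbb{C}^6$), and let $H_A$ and $H_B$ be the cyclic subgroups of $H_6$ generated by $A$ and $B$, respectively. Assume that $H_A\cap H_B\subseteq\zeta(H_6)$, where $\zeta(H_6)$ is the center of $H_6$. Then the orthonormal eigenbases of $A$ and $B$ are mutually unbiased, and these two bases cannot both be contained in a set of four mutually unbiased bases of $\mathbb{C}^6$.
   Context: On $\mathbb{C}^6$ with standard basis $|0\rangle,\dots,|5\rangle$, let $\omega_6=\exp(2\pi i/6)$, $X=\sum_{j=0}^{5}|j+1 \bmod 6\rangle\langle j|$ and $Z=\sum_{j=0}^{5}\omega_6^j|j\rangle\langle j|$. The Heisenberg group $H_6$ is the finite subgroup of $GL(6,\mathbb{C})$ generated by $X$ and $Z$; its elements are uniquely $\omega_6^cX^aZ^b$ with $a,b,c\in\{0,\dots,5\}$, and its center $\zeta(H_6)$ is generated by $\omega_6 I$. Two orthonormal bases of $\mathbb{C}^d$ are mutually unbiased if $|\langle\psi|\psi'\rangle|^2=1/d$ for all $|\psi\rangle$ in the first and $|\psi'\rangle$ in the second; a set of orthonormal bases is a set of mutually unbiased bases if any two distinct members are mutually unbiased.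
   Formalization: The condition on H_A∩H_B is read modulo the center: (H_A ζ)∩(H_B ζ)⊆ζ(H_6). Literally the claim fails: for A=X, B=ω_6X we have H_A∩H_B={I}, but A and B share an eigenbasis. The claim is proved for every choice of orthonormal eigenbases of A and B. *)

theory Defs
  imports
    "HOL-Algebra.Generated_Groups"
    "HOL-Analysis.Complex_Transcendental"
    "Jordan_Normal_Form.Char_Poly"
    "Jordan_Normal_Form.VS_Connect"
begin

definition omega6 :: complex where
  "omega6 = exp (2 * of_real pi * \<i> / 6)"

definition X6 :: "complex mat" where
  "X6 = Matrix.mat 6 6 (\<lambda>(i, j). if i = (j + 1) mod 6 then 1 else 0)"

definition Z6 :: "complex mat" where
  "Z6 = mat_diag 6 (\<lambda>j. omega6 ^ j)"

definition GL6 :: "complex mat monoid" where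
  "GL6 = units_of (ring_mat TYPE(complex) 6 ())"

definition H6 :: "complex mat set" where
  "H6 = generate GL6 {X6, Z6}"

definition center_H6 :: "complex mat set" where
  "center_H6 = {C \<in> H6. \<forall>M \<in> H6. C * M = M * C}"

definition cyclic_subgroup :: "complex mat \<Rightarrow> complex mat set" where
  "cyclic_subgroup A = generate GL6 {A}"

text \<open>The elements of \<open>H6\<close> matter only up to the phases in the center: \<open>X6\<close> and \<open>omega6 \<cdot>\<^sub>m X6\<close>
  have the same eigenvectors, although the cyclic groups they generate meet only in the identity.
  Cyclic subgroups are therefore compared modulo the center, that is, after enlarging each of
  them by the center.\<close>

definition meet_in_center :: "complex mat \<Rightarrow> complex mat \<Rightarrow> bool" where
  "meet_in_center A B \<longleftrightarrow>
     (cyclic_subgroup A <#>\<^bsub>GL6\<^esub> center_H6) \<inter> (cyclic_subgroup B <#>\<^bsub>GL6\<^esub> center_H6) \<subseteq> center_H6"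

definition nondegenerate :: "complex mat \<Rightarrow> bool" where
  "nondegenerate A \<longleftrightarrow> card {k. eigenvalue A k} = 6"

text \<open>A basis is the set of its vectors. The conjugating product \<open>\<bullet>c\<close> conjugates its second
  argument, so it is the usual Hermitian product up to the order of the arguments.\<close>

definition orthonormal_basis :: "nat \<Rightarrow> complex vec set \<Rightarrow> bool" where
  "orthonormal_basis d S \<longleftrightarrow>
     vectorspace.basis class_ring (module_vec TYPE(complex) d) S \<and>
     (\<forall>v \<in> S. \<forall>w \<in> S. v \<bullet>c w = (if v = w then 1 else 0))"

definition orthonormal_eigenbasis :: "nat \<Rightarrow> complex mat \<Rightarrow> complex vec set \<Rightarrow> bool" where
  "orthonormal_eigenbasis d A S \<longleftrightarrow>
     orthonormal_basis d S \<and> (\<forall>v \<in> S. \<exists>k. eigenvector A v k)"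

definition mutually_unbiased :: "nat \<Rightarrow> complex vec set \<Rightarrow> complex vec set \<Rightarrow> bool" where
  "mutually_unbiased d S T \<longleftrightarrow>
     orthonormal_basis d S \<and> orthonormal_basis d T \<and>
     (\<forall>v \<in> S. \<forall>w \<in> T. (cmod (v \<bullet>c w))\<^sup>2 = 1 / real d)"

definition mutually_unbiased_bases :: "nat \<Rightarrow> complex vec set set \<Rightarrow> bool" where
  "mutually_unbiased_bases d \<B> \<longleftrightarrow>
     (\<forall>S \<in> \<B>. orthonormal_basis d S) \<and>
     (\<forall>S \<in> \<B>. \<forall>T \<in> \<B>. S \<noteq> T \<longrightarrow> mutually_unbiased d S T)"

end

(*
  Coordinates. The commutation relation A B = omega6 B A (or its mirror image) makes B shift the
  eigenvectors s_0, ..., s_5 of A cyclically, so the eigenbasis of B is the discrete Fourier transform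
  of that of A. A vector u unbiased to both bases has coordinates x_j = sqrt 6 <u, s_j> that are
  unimodular with flat Fourier transform, i.e. x solves the cyclic 6-roots problem with |x_j| = 1.

  Classification. With Z/6 = Z/2 x Z/3, write y = (x_0, x_4, x_2) and w = (x_3, x_1, x_5), and
  y_b = e_b u_b, w_b = e_b cnj u_b with unimodular e_b, u_b. The autocorrelation equations say that
  E_b = e_(b+1) cnj e_b satisfies two linear relations with real coefficients, formed from the Re u_b
  and from the Im u_b. Either the two relations are proportional, and then w = - i d y with d = 1 or
  d = -1 ("product" vectors); or E_0, E_1, E_2 are parallel, and then (u_0, u_1, u_2) is a multiple of
  a permutation of (1, z, cnj z) with 2 Re z = sqrt 3 - 1 ("skew" vectors, with a similar sign d).

  Conclusion. Computing all overlaps, an unbiased pair consists of a product vector and a skew vector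
  with the same d. Of two mutually unbiased bases of such vectors, one would therefore consist of
  product vectors with one and the same d; but these do not span.
*)

theory Submission
  imports Defs
begin

section \<open>Biunimodular sequences on the cyclic group of order six\<close>

text \<open>The relation A B = omega6 B A is arithmetic modulo 6. Up to phases A = X^a Z^b and B =
  X^a' Z^b', and they commute up to omega6 to the power b a' - b' a. If a prime p in {2, 3} divided
  this exponent, (a', b') would be a multiple of (a, b) modulo p, because non-degeneracy excludes
  (a, b) = 0 modulo p. Then B^(6/p) would be a power of A up to a phase, hence central by
  \<open>meet_in_center\<close>, and p would divide a' and b'. So the exponent is a unit modulo 6,
  and the only units are 1 and -1.

  The cyclic 6-roots equations are nonlinear; what keeps them elementary is the choice e_b^2 = y_b
  w_b. It makes y_b + w_b and y_b - w_b real multiples of e_b and of i e_b, so that the equations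
  become linear in the phases E_b with real coefficients. Such relations between unit numbers can be
  exploited through imaginary parts alone. The constant sqrt 3 - 1 is what remains when the root 1
  is removed from a cubic whose roots have sum sqrt 3 and product 1.\<close>

lemma cnj_unit_mult: "cmod z = 1 \<Longrightarrow> z * cnj z = 1"
  by (simp add: complex_norm_square [symmetric])

text \<open>Conjugation turns the vanishing sum into a vanishing second elementary symmetric
  function, so the three numbers are the roots of X^3 - 1.\<close>

lemma three_phases_sum_zero:
  fixes a b c :: complex
  assumes "cmod a = 1" "cmod b = 1" "cmod c = 1" "a * b * c = 1" "a + b + c = 0"
  shows "a ^ 3 = 1" "b ^ 3 = 1" "c ^ 3 = 1"
proof -
  have n: "a * cnj a = 1" "b * cnj b = 1" "c * cnj c = 1"
    using assms by (auto simp: cnj_unit_mult)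
  have "cnj (a + b + c) = 0" using assms(5) by simp
  then have "cnj a + cnj b + cnj c = 0" by simp
  then have "a * b * c * (cnj a + cnj b + cnj c) = 0" by simp
  moreover have "a * b * c * (cnj a + cnj b + cnj c) = b * c * (a * cnj a) + a * c * (b * cnj b) + a * b * (c * cnj c)"
    by (simp add: algebra_simps)
  ultimately have q: "b * c + a * c + a * b = 0" using n by simp
  have "a * a = b * c" "b * b = a * c" "c * c = a * b"
  proof -
    have "a * a - b * c = a * (a + b + c) - (b * c + a * c + a * b)"
      "b * b - a * c = b * (a + b + c) - (b * c + a * c + a * b)"
      "c * c - a * b = c * (a + b + c) - (b * c + a * c + a * b)"
      by (simp_all add: algebra_simps)
    then show "a * a = b * c" "b * b = a * c" "c * c = a * b"
      using q assms(5) by simp_all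
  qed
  then show "a ^ 3 = 1" "b ^ 3 = 1" "c ^ 3 = 1"
    using assms(4) by (simp_all add: power3_eq_cube mult_ac)
qed

lemma omega6_eq: "omega6 = Complex (1/2) (sqrt 3 / 2)"
proof -
  have "omega6 = cis (pi / 3)"
    by (simp add: omega6_def cis_conv_exp mult.commute)
  then show ?thesis by (simp add: complex_eq_iff cos_60 sin_60)
qed

lemma cmod_omega6: "cmod omega6 = 1"
  by (simp add: omega6_def norm_exp_eq_Re)

lemma omega6_sq: "omega6 ^ 2 = omega6 - 1"
  by (simp add: omega6_eq complex_eq_iff power2_eq_square)

lemma omega6_cube: "omega6 ^ 3 = - 1"
proof -
  have "omega6 ^ 3 = omega6 ^ 2 * omega6" by (simp add: power3_eq_cube power2_eq_square)
  also have "\<dots> = omega6 ^ 2 - omega6" unfolding omega6_sq by (simp add: left_diff_distrib power2_eq_square[symmetric] omega6_sq)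
  finally show ?thesis by (simp add: omega6_sq)
qed

lemma omega6_pow6: "omega6 ^ 6 = 1"
  using power_mult[of omega6 3 2] by (simp add: omega6_cube)

text \<open>On Z/3 the autocorrelation is the inverse Fourier transform of the power spectrum. For
  the constant spectrum 6 it vanishes at shift 1 and equals 6 at shift 0. Here \<open>t\<close> is a
  primitive cube root of unity.\<close>

lemma flat_spectrum_3:
  fixes p q r t :: complex
  assumes t: "t ^ 2 + t + 1 = 0" "cnj t = t ^ 2"
    and "cmod (p + q + r) ^ 2 = 6" "cmod (p + q * t + r * t ^ 2) ^ 2 = 6"
    "cmod (p + q * t ^ 2 + r * t) ^ 2 = 6"
  shows "q * cnj p + r * cnj q + p * cnj r = 0" "cmod p ^ 2 + cmod q ^ 2 + cmod r ^ 2 = 6"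
proof -
  have tt: "t * t = - 1 - t" "\<And>x. t * (t * x) = (- 1 - t) * x"
  proof -
    show *: "t * t = - 1 - t" using t(1) by (simp add: power2_eq_square eq_neg_iff_add_eq_0 algebra_simps)
    fix x show "t * (t * x) = (- 1 - t) * x" by (metis * mult.assoc)
  qed
  have c2: "cnj (t ^ 2) = t" using t(2) by (simp add: power2_eq_square tt algebra_simps)
  have N0: "(p + q + r) * (cnj p + cnj q + cnj r) = 6"
    using assms(3) complex_norm_square[of "p + q + r"] by simp
  have N1: "(p + q * t + r * t ^ 2) * (cnj p + cnj q * t ^ 2 + cnj r * t) = 6"
    using assms(4) complex_norm_square[of "p + q * t + r * t ^ 2"] c2 t(2)
    by (simp only: complex_cnj_add complex_cnj_mult of_real_numeral)
  have N2: "(p + q * t ^ 2 + r * t) * (cnj p + cnj q * t + cnj r * t ^ 2) = 6"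
    using assms(5) complex_norm_square[of "p + q * t ^ 2 + r * t"] c2 t(2)
    by (simp only: complex_cnj_add complex_cnj_mult of_real_numeral)
  have *: "3 * (q * cnj p + r * cnj q + p * cnj r) =
      (p + q + r) * (cnj p + cnj q + cnj r) +
      t ^ 2 * ((p + q * t + r * t ^ 2) * (cnj p + cnj q * t ^ 2 + cnj r * t)) +
      t * ((p + q * t ^ 2 + r * t) * (cnj p + cnj q * t + cnj r * t ^ 2))"
    by (simp add: power2_eq_square algebra_simps tt)
  have **: "3 * (p * cnj p + q * cnj q + r * cnj r) =
      (p + q + r) * (cnj p + cnj q + cnj r) +
      (p + q * t + r * t ^ 2) * (cnj p + cnj q * t ^ 2 + cnj r * t) +
      (p + q * t ^ 2 + r * t) * (cnj p + cnj q * t + cnj r * t ^ 2)"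
    by (simp add: power2_eq_square algebra_simps tt)
  have "3 * (q * cnj p + r * cnj q + p * cnj r) = 0"
  proof -
    have "6 + t ^ 2 * 6 + t * 6 = 6 * (t ^ 2 + t + 1)" by simp
    then show ?thesis unfolding * N0 N1 N2 t(1) by simp
  qed
  then show "q * cnj p + r * cnj q + p * cnj r = 0" by (simp only: mult_eq_0_iff) simp
  have "3 * (p * cnj p + q * cnj q + r * cnj r) = 18"
    unfolding ** N0 N1 N2 by simp
  then have "p * cnj p + q * cnj q + r * cnj r = 6"
    using mult_left_cancel[of "3 :: complex" _ 6] by fastforce
  then have "complex_of_real (cmod p ^ 2 + cmod q ^ 2 + cmod r ^ 2) = of_real 6"
    using complex_norm_square[of p] complex_norm_square[of q] complex_norm_square[of r] by simp
  then show "cmod p ^ 2 + cmod q ^ 2 + cmod r ^ 2 = 6"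
    using of_real_eq_iff by blast
qed


section \<open>Shapes of the biunimodular sequences\<close>

text \<open>Three orders cover all six permutations of (1, z, cnj z), because cnj z satisfies the
  conditions on z as well.\<close>

definition skew_triple :: "complex \<Rightarrow> complex \<Rightarrow> complex \<Rightarrow> bool" where
  "skew_triple u v w \<longleftrightarrow> (\<exists>z. cmod z = 1 \<and> 2 * Re z = sqrt 3 - 1 \<and>
     (u, v, w) \<in> {(1, z, cnj z), (z, 1, cnj z), (z, cnj z, 1)})"

lemma unit_pair_conj:
  assumes "cmod v = 1" "cmod w = 1" "v * w = 1"
  shows "w = cnj v"
proof -
  have "cnj v * (v * w) = w" using cnj_unit_mult[OF assms(1)] by (simp add: mult_ac)
  then show ?thesis using assms(3) by simp
qed

text \<open>Conjugating the sum shows that the second symmetric function is sqrt 3 times the product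
  a. So a is real, hence 1 or -1, and it is itself a root of the cubic X^3 - sqrt 3 X^2 + a sqrt 3 X
  - a with roots u, v, w.\<close>

lemma skew_tripleI:
  assumes v: "cmod u = 1" "cmod v = 1" "cmod w = 1"
    and sum: "u + v + w = of_real (sqrt 3)" and "Im (u * v + v * w + w * u) = 0"
  shows "skew_triple u v w"
proof -
  define a where "a = u * v * w"
  define q where "q = complex_of_real (sqrt 3)"
  have n: "u * cnj u = 1" "v * cnj v = 1" "w * cnj w = 1"
    using v by (auto simp: cnj_unit_mult)
  have "cnj (u + v + w) = q" using sum by (simp add: q_def)
  then have "a * (cnj u + cnj v + cnj w) = a * q" by simp
  moreover have "a * (cnj u + cnj v + cnj w) = v * w * (u * cnj u) + u * w * (v * cnj v) + u * v * (w * cnj w)"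
    by (simp add: a_def algebra_simps)
  ultimately have e2: "u * v + v * w + w * u = a * q" using n by (simp add: algebra_simps)
  have "Im (a * q) = 0" using assms(5) e2 by simp
  then have "Im a = 0" by (simp add: q_def)
  moreover have "cmod a = 1" using v by (simp add: a_def norm_mult)
  ultimately have a: "a = 1 \<or> a = -1"
    by (auto simp: complex_eq_iff cmod_def power2_eq_square real_sqrt_eq_1_iff square_eq_1_iff)
  have aa: "a * a = 1" using a by auto
  \<comment> \<open>Up to sign, this is the cubic with roots u, v, w evaluated at a.\<close>
  have "(u - a) * (v - a) * (w - a) = u * v * w - a * (u * v + v * w + w * u) + a * a * (u + v + w) - a * a * a"
    by (simp add: algebra_simps)
  also have "\<dots> = 0" using e2 sum aa by (simp add: a_def[symmetric] q_def[symmetric] mult.assoc[symmetric])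
  finally have root: "u = a \<or> v = a \<or> w = a" by auto
  have s3: "sqrt 3 > 1" by (simp add: real_less_rsqrt)
  have two: "cmod (x + y) \<le> 2" if "cmod x = 1" "cmod y = 1" for x y
    using norm_triangle_ineq[of x y] that by simp
  have pq: "a = 1 \<and> 2 * Re z = sqrt 3 - 1 \<and> z' = cnj z"
    if "cmod z = 1" "cmod z' = 1" "a + z + z' = q" "a * z * z' = a" for z z'
  proof -
    have "z + z' = q - a" using that(3) by (simp add: algebra_simps)
    \<comment> \<open>For a = -1 the two remaining unit numbers would add up to sqrt 3 + 1 >
      2.\<close>
    have "a = 1"
    proof (rule ccontr)
      assume "a \<noteq> 1"
      then have "z + z' = of_real (sqrt 3 + 1)" using a \<open>z + z' = q - a\<close> by (simp add: q_def)
      then have "cmod (z + z') = \<bar>sqrt 3 + 1\<bar>" by (simp only: norm_of_real)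
      then show False using two[OF that(1,2)] s3 by simp
    qed
    then have "z' = cnj z" using unit_pair_conj that by simp
    moreover have "Re (z + z') = sqrt 3 - 1" using \<open>z + z' = q - a\<close> \<open>a = 1\<close> by (simp add: q_def)
    ultimately show ?thesis using \<open>a = 1\<close> by simp
  qed
  from root show ?thesis
  proof (elim disjE)
    assume e: "u = a"
    have "a * v * w = u * v * w" by (simp add: e)
    then have "a * v * w = a" by (simp only: a_def)
    moreover have "a + v + w = q" using sum by (simp add: e q_def)
    ultimately have "a = 1 \<and> 2 * Re v = sqrt 3 - 1 \<and> w = cnj v"
      using pq[of v w] v by blast
    then show ?thesis using v e by (auto simp: skew_triple_def)
  next
    assume e: "v = a"
    have "a * u * w = u * v * w" by (simp add: e mult_ac)
    then have "a * u * w = a" by (simp only: a_def)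
    moreover have "a + u + w = q" using sum by (simp add: e q_def add_ac)
    ultimately have "a = 1 \<and> 2 * Re u = sqrt 3 - 1 \<and> w = cnj u"
      using pq[of u w] v by blast
    then show ?thesis using v e by (auto simp: skew_triple_def)
  next
    assume e: "w = a"
    have "a * u * v = u * v * w" by (simp add: e mult_ac)
    then have "a * u * v = a" by (simp only: a_def)
    moreover have "a + u + v = q" using sum by (simp add: e q_def add_ac)
    ultimately have "a = 1 \<and> 2 * Re u = sqrt 3 - 1 \<and> v = cnj u"
      using pq[of u v] v by blast
    then show ?thesis using v e by (auto simp: skew_triple_def)
  qed
qed

text \<open>By the Chinese remainder theorem j is the pair (j mod 2, j mod 3). Along 0, 4, 2 and
  along 3, 1, 5 the residues modulo 3 are 0, 1, 2, so the even and odd entries are the triples y and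
  w. In both cases of the classification a square root of i d is factored out of the u_b;
  conjugating it costs the factor -i d in the odd entries.\<close>

definition crt_vector :: "real \<Rightarrow> complex \<Rightarrow> (nat \<Rightarrow> complex) \<Rightarrow> (nat \<Rightarrow> complex) \<Rightarrow> nat \<Rightarrow> complex" where
  "crt_vector d g e v j = (if even j then g * e (j mod 3) * v (j mod 3)
     else - \<i> * d * g * e (j mod 3) * cnj (v (j mod 3)))"

text \<open>A tensor product along Z/2 x Z/3: the pair (1, -i d) times a triple of cube roots of
  unity.\<close>

definition product_vector :: "real \<Rightarrow> (nat \<Rightarrow> complex) \<Rightarrow> bool" where
  "product_vector d x \<longleftrightarrow> (\<exists>g e. cmod g = 1 \<and> (\<forall>b. e b ^ 3 = 1) \<and>
     (\<forall>j<6. x j = crt_vector d g e (\<lambda>_. 1) j))"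

definition skew_vector :: "real \<Rightarrow> (nat \<Rightarrow> complex) \<Rightarrow> bool" where
  "skew_vector d x \<longleftrightarrow> (\<exists>g c v. cmod g = 1 \<and> c ^ 3 = 1 \<and> skew_triple (v 0) (v 1) (v 2) \<and>
     (\<forall>j<6. x j = crt_vector d g (\<lambda>b. c ^ b) v j))"

definition biunimodular :: "(nat \<Rightarrow> complex) \<Rightarrow> bool" where
  "biunimodular x \<longleftrightarrow> (\<forall>j<6. cmod (x j) = 1) \<and>
     (\<forall>k<6. (cmod (\<Sum>j<6. x j * cnj (omega6 ^ (k * j))))\<^sup>2 = 6)"

lemma less_6_cases: "(\<forall>j<6::nat. P j) \<longleftrightarrow> P 0 \<and> P 1 \<and> P 2 \<and> P 3 \<and> P 4 \<and> P 5"
  by (simp add: All_less_Suc numeral_eq_Suc conj_ac)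

text \<open>The three ratios E_b multiply to 1, so their common value is a cube root of unity, and
  the relations say that the mixed products of the Re u_b, and those of the Im u_b, sum to 0. Hence
  the sum of the Re u_b and the sum of the Im u_b both have square 3 / 2 and agree up to a sign
  d.\<close>

lemma skew_vector_of_equal_phases:
  assumes e: "cmod e0 = 1" "cmod e1 = 1" "cmod e2 = 1"
    and u: "cmod u0 = 1" "cmod u1 = 1" "cmod u2 = 1"
    and E: "e2 * cnj e1 = e1 * cnj e0" "e0 * cnj e2 = e1 * cnj e0"
    and c: "Re u1 * Re u0 * (e1 * cnj e0) + Re u2 * Re u1 * (e2 * cnj e1) + Re u0 * Re u2 * (e0 * cnj e2) = 0"
    and s: "Im u1 * Im u0 * (e1 * cnj e0) + Im u2 * Im u1 * (e2 * cnj e1) + Im u0 * Im u2 * (e0 * cnj e2) = 0"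
    and n: "(Re u0)\<^sup>2 + (Re u1)\<^sup>2 + (Re u2)\<^sup>2 = 3 / 2"
    and x: "x 0 = e0 * u0" "x 4 = e1 * u1" "x 2 = e2 * u2"
      "x 3 = e0 * cnj u0" "x 1 = e1 * cnj u1" "x 5 = e2 * cnj u2"
  shows "\<exists>d\<in>{1, -1}. skew_vector d x"
proof -
  define \<epsilon> where "\<epsilon> = e1 * cnj e0"
  have en: "e0 * cnj e0 = 1" "e1 * cnj e1 = 1" "e2 * cnj e2 = 1"
    using e by (auto simp: cnj_unit_mult)
  have e1: "e1 = \<epsilon> * e0" using en by (simp add: \<epsilon>_def mult_ac)
  have e2: "e2 = \<epsilon>^2 * e0"
  proof -
    have "e2 * cnj e1 * e1 = \<epsilon> * (\<epsilon> * e0)" by (metis E(1) \<epsilon>_def e1)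
    moreover have "e2 * cnj e1 * e1 = e2 * (e1 * cnj e1)" by (simp add: mult_ac)
    ultimately show ?thesis using en by (simp add: power2_eq_square mult_ac)
  qed
  have \<epsilon>n: "cmod \<epsilon> = 1" using e by (simp add: \<epsilon>_def norm_mult)
  have e3: "\<epsilon> ^ 3 = 1"
  proof -
    have "\<epsilon> * \<epsilon> * \<epsilon> = (e1 * cnj e0) * (e2 * cnj e1) * (e0 * cnj e2)" unfolding E \<epsilon>_def ..
    also have "\<dots> = (e0 * cnj e0) * (e1 * cnj e1) * (e2 * cnj e2)" by (simp add: mult_ac)
    finally show ?thesis using en by (simp add: power3_eq_cube)
  qed
  have un: "(Re u0)\<^sup>2 + (Im u0)\<^sup>2 = 1" "(Re u1)\<^sup>2 + (Im u1)\<^sup>2 = 1" "(Re u2)\<^sup>2 + (Im u2)\<^sup>2 = 1"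
    using u by (auto simp: cmod_power2[symmetric])
  define P where "P = Re u1 * Re u0 + Re u2 * Re u1 + Re u0 * Re u2"
  define Q where "Q = Im u1 * Im u0 + Im u2 * Im u1 + Im u0 * Im u2"
  have "of_real P * \<epsilon> = 0" using c unfolding E by (simp add: P_def \<epsilon>_def algebra_simps)
  then have P: "P = 0" using \<epsilon>n by auto
  have "of_real Q * \<epsilon> = 0" using s unfolding E by (simp add: Q_def \<epsilon>_def algebra_simps)
  then have Q: "Q = 0" using \<epsilon>n by auto
  define C where "C = Re u0 + Re u1 + Re u2"
  define S where "S = Im u0 + Im u1 + Im u2"
  have "C\<^sup>2 = (Re u0)\<^sup>2 + (Re u1)\<^sup>2 + (Re u2)\<^sup>2 + 2 * P"
    by (simp add: C_def P_def power2_eq_square algebra_simps)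
  then have C: "C\<^sup>2 = 3 / 2" using n P by simp
  have "S\<^sup>2 = (Im u0)\<^sup>2 + (Im u1)\<^sup>2 + (Im u2)\<^sup>2 + 2 * Q"
    by (simp add: S_def Q_def power2_eq_square algebra_simps)
  then have S: "S\<^sup>2 = 3 / 2" using n Q un by simp
  from S C have "S\<^sup>2 = C\<^sup>2" by simp
  then have "S = C \<or> S = - C" by (simp only: power2_eq_iff)
  then have "\<exists>d\<in>{1, - 1}. S = d * C" by simp
  then obtain d :: real where d: "d \<in> {1, -1}" "S = d * C" by blast
  have dd: "d * d = 1" using d by auto
  \<comment> \<open>The direction of u_0 + u_1 + u_2 = C (1 + i d), which has modulus sqrt 3.
    Rotating by \<open>cnj z\<close> makes this sum real.\<close>
  define z where "z = Complex C (d * C) / sqrt 3"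
  have C': "C * C = 3 / 2" using C by (simp add: power2_eq_square)
  have zz: "z\<^sup>2 = \<i> * d"
    by (simp add: z_def complex_eq_iff power2_eq_square power_divide C' dd mult_ac) (simp add: C' dd mult.assoc[symmetric])
  have "cmod z ^ 2 = 1" 
    by (simp add: z_def norm_divide power_divide cmod_power2 power_mult_distrib C) (use d in auto)
  then have zn: "cmod z = 1" by (simp add: power2_eq_1_iff) (use norm_ge_zero[of z] in linarith)
  note zc = cnj_unit_mult[OF zn]
  define v where "v = (\<lambda>b::nat. (if b = 0 then u0 else if b = 1 then u1 else u2) * cnj z)"
  have "skew_triple (v 0) (v 1) (v 2)"
  proof (rule skew_tripleI)
    show "cmod (v 0) = 1" "cmod (v 1) = 1" "cmod (v 2) = 1" using u zn by (auto simp: v_def norm_mult)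
    have "u0 + u1 + u2 = z * sqrt 3" using d(2) by (simp add: z_def C_def S_def complex_eq_iff)
    then have "(u0 + u1 + u2) * cnj z = (z * cnj z) * sqrt 3" by (simp add: mult_ac)
    then show "v 0 + v 1 + v 2 = of_real (sqrt 3)" using zc by (simp add: v_def algebra_simps)
    have "cnj (z\<^sup>2) = - \<i> * d" unfolding zz by simp
    then have *: "cnj z * cnj z = - \<i> * d" by (simp add: power2_eq_square)
    \<comment> \<open>The second symmetric function of the u_b has real part P - Q = 0, so
      multiplying it by -i d makes it real.\<close>
    have "v 0 * v 1 + v 1 * v 2 + v 2 * v 0 = (cnj z * cnj z) * (u0 * u1 + u1 * u2 + u2 * u0)"
      by (simp add: v_def algebra_simps)
    moreover have "Re (u0 * u1 + u1 * u2 + u2 * u0) = P - Q"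
      by (simp add: P_def Q_def algebra_simps)
    moreover have "Im (- \<i> * complex_of_real d * w) = - d * Re w" for w by simp
    ultimately show "Im (v 0 * v 1 + v 1 * v 2 + v 2 * v 0) = 0"
      unfolding * P Q by simp
  qed
  moreover have "\<forall>j<6. x j = crt_vector d (e0 * z) (\<lambda>b. \<epsilon> ^ b) v j"
  proof -
    have a: "e0 * z * f * (u * cnj z) = f * e0 * u" for f u
    proof -
      have "e0 * z * f * (u * cnj z) = f * e0 * u * (z * cnj z)" by (simp add: mult_ac)
      then show ?thesis by (simp add: zc)
    qed
    have b: "- \<i> * d * (e0 * z) * f * cnj (u * cnj z) = f * e0 * cnj u" for f u
    proof -
      have "- \<i> * d * (e0 * z) * f * cnj (u * cnj z) = f * e0 * cnj u * (- \<i> * d * z\<^sup>2)"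
        by (simp add: power2_eq_square mult_ac)
      also have "- \<i> * d * z\<^sup>2 = of_real (d * d)" unfolding zz by (simp add: complex_eq_iff)
      finally show ?thesis unfolding dd by simp
    qed
    show ?thesis unfolding less_6_cases crt_vector_def v_def a b x by (simp add: e1 e2)
  qed
  ultimately show ?thesis using d(1) e zn e3 unfolding skew_vector_def
    by (metis norm_mult mult_1)
qed


section \<open>Real relations between phases and the classification\<close>

text \<open>After a rotation that takes x to 1, the imaginary parts of the two relations form a
  homogeneous system in two unknowns with determinant \<open>b * c' - c * b'\<close>. So y and z
  become real unit numbers.\<close>

lemma collinear_phases:
  fixes a b c a' b' c' :: real and x y z :: complex
  assumes n: "cmod x = 1" "cmod y = 1" "cmod z = 1"
    and r: "a * x + b * y + c * z = 0" "a' * x + b' * y + c' * z = 0"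
    and "b * c' \<noteq> c * b'"
  shows "(y = x \<or> y = - x) \<and> (z = x \<or> z = - x)"
proof -
  have xx: "x * cnj x = 1" using n by (simp add: cnj_unit_mult)
  define f where "f = y * cnj x"
  define g where "g = z * cnj x"
  have "(a * x + b * y + c * z) * cnj x = 0" "(a' * x + b' * y + c' * z) * cnj x = 0"
    using r by simp_all
  then have "a * (x * cnj x) + b * f + c * g = 0" "a' * (x * cnj x) + b' * f + c' * g = 0"
    by (simp_all add: f_def g_def algebra_simps)
  then have "Im (a + b * f + c * g) = 0" "Im (a' + b' * f + c' * g) = 0" by (simp_all add: xx)
  then have i: "b * Im f + c * Im g = 0" "b' * Im f + c' * Im g = 0" by simp_all
  have "(b * c' - c * b') * Im f = c' * (b * Im f + c * Im g) - c * (b' * Im f + c' * Im g)"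
    "(b * c' - c * b') * Im g = b * (b' * Im f + c' * Im g) - b' * (b * Im f + c * Im g)"
    by (simp_all add: algebra_simps)
  then have "Im f = 0" "Im g = 0" using i assms(6) by auto
  moreover have "cmod f = 1" "cmod g = 1" using n by (auto simp: f_def g_def norm_mult)
  ultimately have "f = 1 \<or> f = - 1" "g = 1 \<or> g = - 1"
    by (auto simp: complex_eq_iff cmod_def)
  moreover have "y = f * x" "z = g * x" using xx by (simp_all add: f_def g_def mult_ac)
  ultimately show ?thesis by auto
qed

text \<open>If one factor vanished, a single term of the relation would be left, so a second factor
  would vanish too; the third cannot supply the sum 3 / 2 alone.\<close>

lemma relation_factors_nonzero:
  fixes a b c :: real and x y z :: complex
  assumes "cmod x = 1" "cmod y = 1" "cmod z = 1"
    and "a\<^sup>2 \<le> 1" "b\<^sup>2 \<le> 1" "c\<^sup>2 \<le> 1" "a\<^sup>2 + b\<^sup>2 + c\<^sup>2 = 3 / 2"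
    and "b * a * x + c * b * y + a * c * z = 0"
  shows "a \<noteq> 0 \<and> b \<noteq> 0 \<and> c \<noteq> 0"
proof (rule ccontr)
  assume "\<not> ?thesis"
  then consider "a = 0" | "b = 0" | "c = 0" by blast
  then have "a = 0 \<and> b = 0 \<or> b = 0 \<and> c = 0 \<or> a = 0 \<and> c = 0"
    using assms by cases auto
  then show False using assms by auto
qed

text \<open>A square root e of y w bisects the two phases, so that y / e and w / e are
  conjugate.\<close>

lemma polar_pair:
  assumes "cmod y = 1" "cmod w = 1"
  obtains e u where "cmod e = 1" "cmod u = 1" "y = e * u" "w = e * cnj u"
proof
  define e where "e = csqrt (y * w)"
  have "cmod (e ^ 2) = 1" using assms by (simp add: e_def norm_mult)
  then have "cmod e ^ 2 = 1" by (simp add: norm_power)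
  then show e: "cmod e = 1" by (simp add: power2_eq_1_iff) (use norm_ge_zero[of e] in linarith)
  show "cmod (y * cnj e) = 1" using e assms by (simp add: norm_mult)
  show "y = e * (y * cnj e)" using cnj_unit_mult[OF e] by (simp add: mult_ac)
  have "e * cnj (y * cnj e) = e ^ 2 * cnj y" by (simp add: power2_eq_square mult_ac)
  also have "\<dots> = w * (y * cnj y)" by (simp add: e_def mult_ac)
  finally show "w = e * cnj (y * cnj e)" using cnj_unit_mult[OF assms(1)] by simp
qed

lemma omega6_power_mod: "omega6 ^ n = omega6 ^ (n mod 6)"
proof -
  have "omega6 ^ n = omega6 ^ (6 * (n div 6) + n mod 6)" by simp
  also have "\<dots> = omega6 ^ (n mod 6)" by (simp only: power_add power_mult omega6_pow6 power_one mult_1)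
  finally show ?thesis .
qed

lemma omega6_powers: "omega6 ^ 4 = - omega6" "omega6 ^ 5 = 1 - omega6"
proof -
  have "omega6 ^ 4 = omega6 ^ 3 * omega6" "omega6 ^ 5 = omega6 ^ 3 * omega6 ^ 2"
    by (simp_all flip: power_add power_Suc2)
  then show "omega6 ^ 4 = - omega6" "omega6 ^ 5 = 1 - omega6"
    unfolding omega6_cube omega6_sq by simp_all
qed

lemma lessThan_6: "{..<6::nat} = {0, 1, 2, 3, 4, 5}"
  by auto

text \<open>The transform on Z/6 factors along Z/2 x Z/3. The even frequencies (s = 1) and the odd
  ones (s = -1) are the three-point transforms of the triple x_0 + s x_3, x_4 + s x_1, x_2 + s
  x_5.\<close>

lemma biunimodular_flat:
  assumes "biunimodular x"
    and s: "s = 1 \<or> s = - 1"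
  shows "(x 4 + s * x 1) * cnj (x 0 + s * x 3) + (x 2 + s * x 5) * cnj (x 4 + s * x 1)
      + (x 0 + s * x 3) * cnj (x 2 + s * x 5) = 0"
    and "(cmod (x 0 + s * x 3))\<^sup>2 + (cmod (x 4 + s * x 1))\<^sup>2 + (cmod (x 2 + s * x 5))\<^sup>2 = 6"
proof -
  \<comment> \<open>This is the conjugate of omega6^2, a primitive cube root of unity.\<close>
  define t where "t = cnj omega6 - 1"
  have "cnj (omega6 ^ 2) = cnj (omega6 - 1)" by (simp only: omega6_sq)
  then have c2: "cnj omega6 ^ 2 = cnj omega6 - 1" by simp
  then have t2: "t ^ 2 = - cnj omega6" 
    by (simp add: t_def power2_eq_square algebra_simps)
  have t: "t ^ 2 + t + 1 = 0" unfolding t2 by (simp add: t_def)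
  have ct: "cnj t = t ^ 2" unfolding t2 by (simp add: t_def omega6_eq complex_eq_iff)
  have x: "(cmod (\<Sum>j<6. x j * cnj (omega6 ^ (k * j))))\<^sup>2 = 6" if "k < 6" for k
    using assms(1) that by (simp add: biunimodular_def)
  have S: "(\<Sum>j<6. f j) = f 0 + f 1 + f 2 + f 3 + f 4 + f 5" for f :: "nat \<Rightarrow> complex"
    by (simp add: lessThan_6 add.assoc)
  have pw: "omega6 ^ 6 = 1" "omega6 ^ 8 = omega6 - 1" "omega6 ^ 9 = - 1" "omega6 ^ 10 = - omega6"
     "omega6 ^ 12 = 1" "omega6 ^ 15 = - 1" "omega6 ^ 16 = - omega6" "omega6 ^ 20 = omega6 - 1" "omega6 ^ 25 = omega6"
    by (subst omega6_power_mod, simp add: omega6_powers omega6_sq omega6_cube)+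
  note f = x[of 0] x[of 1] x[of 2] x[of 3] x[of 4] x[of 5]
  note f = f[unfolded S, simplified, unfolded complex_cnj_power[symmetric] pw omega6_powers omega6_sq omega6_cube]
  from s have "(cmod ((x 0 + s * x 3) + (x 4 + s * x 1) + (x 2 + s * x 5)))\<^sup>2 = 6 \<and>
     (cmod ((x 0 + s * x 3) + (x 4 + s * x 1) * t + (x 2 + s * x 5) * t ^ 2))\<^sup>2 = 6 \<and>
     (cmod ((x 0 + s * x 3) + (x 4 + s * x 1) * t ^ 2 + (x 2 + s * x 5) * t))\<^sup>2 = 6"
    unfolding t2 unfolding t_def
    using f by (auto simp: algebra_simps)
  then show "(x 4 + s * x 1) * cnj (x 0 + s * x 3) + (x 2 + s * x 5) * cnj (x 4 + s * x 1)
      + (x 0 + s * x 3) * cnj (x 2 + s * x 5) = 0"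
    "(cmod (x 0 + s * x 3))\<^sup>2 + (cmod (x 4 + s * x 1))\<^sup>2 + (cmod (x 2 + s * x 5))\<^sup>2 = 6"
    using flat_spectrum_3[OF t ct] by blast+
qed


text \<open>Unit numbers with proportional real and imaginary parts agree up to sign, so u_1 and u_2
  are u_0 or -u_0. Then (Re u_0)^2 = 1 / 2 makes u_0 a primitive eighth root of unity, and the
  relation becomes a vanishing sum of three phases with product 1.\<close>

lemma product_vector_of_parallel:
  assumes e: "cmod e0 = 1" "cmod e1 = 1" "cmod e2 = 1"
    and u: "cmod u0 = 1" "cmod u1 = 1" "cmod u2 = 1"
    and r: "Re u1 * Re u0 * (e1 * cnj e0) + Re u2 * Re u1 * (e2 * cnj e1) + Re u0 * Re u2 * (e0 * cnj e2) = 0"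
    and n: "(Re u0)\<^sup>2 + (Re u1)\<^sup>2 + (Re u2)\<^sup>2 = 3 / 2"
    and par: "Re u1 * Im u0 = Re u0 * Im u1" "Re u2 * Im u0 = Re u0 * Im u2"
    and nz: "Re u0 \<noteq> 0"
    and x: "x 0 = e0 * u0" "x 4 = e1 * u1" "x 2 = e2 * u2"
      "x 3 = e0 * cnj u0" "x 1 = e1 * cnj u1" "x 5 = e2 * cnj u2"
  shows "\<exists>d\<in>{1, -1}. product_vector d x"
proof -
  have en: "e0 * cnj e0 = 1" "e1 * cnj e1 = 1" "e2 * cnj e2 = 1"
    using e by (auto simp: cnj_unit_mult)
  have un: "(Re u0)\<^sup>2 + (Im u0)\<^sup>2 = 1" "(Re u1)\<^sup>2 + (Im u1)\<^sup>2 = 1" "(Re u2)\<^sup>2 + (Im u2)\<^sup>2 = 1"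
    using u by (auto simp: cmod_power2[symmetric])
  have sgn: "\<exists>\<sigma>\<in>{1, -1}. u = complex_of_real \<sigma> * u0 \<and> (Re u)\<^sup>2 = (Re u0)\<^sup>2"
    if p: "Re u * Im u0 = Re u0 * Im u" and "(Re u)\<^sup>2 + (Im u)\<^sup>2 = 1" for u
  proof -
    have "(Re u)\<^sup>2 * (Im u0)\<^sup>2 = (Re u0)\<^sup>2 * (Im u)\<^sup>2" using p by (metis power_mult_distrib)
    moreover have "(Im u0)\<^sup>2 = 1 - (Re u0)\<^sup>2" "(Im u)\<^sup>2 = 1 - (Re u)\<^sup>2" using un(1) that(2) by auto
    ultimately have sq: "(Re u)\<^sup>2 = (Re u0)\<^sup>2" by (simp add: algebra_simps)
    then have "Re u = Re u0 \<or> Re u = - Re u0" by (simp only: power2_eq_iff)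
    then have "u = u0 \<or> u = - u0"
    proof
      assume "Re u = Re u0"
      then show ?thesis using p nz by (simp add: complex_eq_iff)
    next
      assume r: "Re u = - Re u0"
      then have "Re u0 * Im u = Re u0 * - Im u0" using p by simp
      then have "Im u = - Im u0" using nz by (simp only: mult_cancel_left) simp
      with r show ?thesis by (simp add: complex_eq_iff)
    qed
    then show ?thesis using sq by auto
  qed
  obtain \<sigma> where \<sigma>: "\<sigma> \<in> {1, -1}" "u1 = complex_of_real \<sigma> * u0" "(Re u1)\<^sup>2 = (Re u0)\<^sup>2"
    using sgn[OF par(1) un(2)] by blast
  obtain \<tau> where \<tau>: "\<tau> \<in> {1, -1}" "u2 = complex_of_real \<tau> * u0" "(Re u2)\<^sup>2 = (Re u0)\<^sup>2"
    using sgn[OF par(2) un(3)] by blast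
  have "(Re u0)\<^sup>2 = 1 / 2" "(Im u0)\<^sup>2 = 1 / 2" using n un(1) \<sigma>(3) \<tau>(3) by auto
  then have "(Im u0)\<^sup>2 = (Re u0)\<^sup>2" by simp
  then have "Im u0 = Re u0 \<or> Im u0 = - Re u0" by (simp only: power2_eq_iff)
  then have "\<exists>d\<in>{1, - 1}. Im u0 = d * Re u0" by simp
  then obtain d :: real where d: "d \<in> {1, -1}" "Im u0 = d * Re u0" by blast
  have cu: "cnj u0 = - \<i> * d * u0" using d by (auto simp: complex_eq_iff)
  have ss: "\<sigma> * \<sigma> = 1" "\<tau> * \<tau> = 1" using \<sigma>(1) \<tau>(1) by auto
  \<comment> \<open>The signs of u_1 and u_2 relative to u_0 are absorbed into the cube roots of
    unity.\<close>
  define f where "f = (\<lambda>b::nat. if b = 1 then \<sigma> * e1 * cnj e0 else if b = 2 then \<tau> * e2 * cnj e0 else 1)"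
  have "(Re u0)\<^sup>2 * (\<sigma> * e1 * cnj e0 + \<sigma> * \<tau> * e2 * cnj e1 + \<tau> * e0 * cnj e2) = 0"
    using r \<sigma>(2) \<tau>(2) by (simp add: power2_eq_square algebra_simps)
  then have sum: "\<sigma> * e1 * cnj e0 + \<sigma> * \<tau> * e2 * cnj e1 + \<tau> * e0 * cnj e2 = 0" using nz by simp
  have prod: "(\<sigma> * e1 * cnj e0) * (\<sigma> * \<tau> * e2 * cnj e1) * (\<tau> * e0 * cnj e2) = 1"
  proof -
    have "(\<sigma> * e1 * cnj e0) * (\<sigma> * \<tau> * e2 * cnj e1) * (\<tau> * e0 * cnj e2)
      = complex_of_real (\<sigma> * \<sigma>) * complex_of_real (\<tau> * \<tau>) * (e0 * cnj e0) * (e1 * cnj e1) * (e2 * cnj e2)"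
      by (simp add: mult_ac)
    then show ?thesis unfolding ss en by simp
  qed
  have ab: "\<bar>\<sigma>\<bar> = 1" "\<bar>\<tau>\<bar> = 1" using \<sigma>(1) \<tau>(1) by auto
  have unit: "cmod (\<sigma> * e1 * cnj e0) = 1" "cmod (\<sigma> * \<tau> * e2 * cnj e1) = 1" "cmod (\<tau> * e0 * cnj e2) = 1"
    using e ab by (simp_all add: norm_mult)
  note cubes = three_phases_sum_zero[OF unit prod sum]
  \<comment> \<open>The third phase is the conjugate of \<open>f 2\<close>.\<close>
  have "cnj ((\<tau> * e0 * cnj e2) ^ 3) = 1" using cubes(3) by simp
  then have "(\<tau> * e2 * cnj e0) ^ 3 = 1" by (simp add: mult_ac)
  with cubes(1) have "\<forall>b. f b ^ 3 = 1" by (simp add: f_def)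
  moreover have "\<forall>j<6. x j = crt_vector d (e0 * u0) f (\<lambda>_. 1) j"
  proof -
    have a: "e0 * (cnj e0 * y) = y" for y using en(1) by (simp add: mult.assoc[symmetric])
    show ?thesis
      by (simp add: less_6_cases crt_vector_def x x(5)[unfolded One_nat_def] f_def \<sigma>(2) \<tau>(2) cu mult_ac a)
  qed
  moreover have "cmod (e0 * u0) = 1" using e u by (simp add: norm_mult)
  ultimately show ?thesis using d(1) unfolding product_vector_def by blast
qed

lemma biunimodular_cases:
  assumes x: "biunimodular x"
  shows "\<exists>d\<in>{1, -1}. product_vector d x \<or> skew_vector d x"
proof -
  have n: "\<forall>j<6. cmod (x j) = 1" using x by (simp add: biunimodular_def)
  obtain e0 u0 where p0: "cmod e0 = 1" "cmod u0 = 1" "x 0 = e0 * u0" "x 3 = e0 * cnj u0"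
    using polar_pair[of "x 0" "x 3"] n by auto
  obtain e1 u1 where p1: "cmod e1 = 1" "cmod u1 = 1" "x 4 = e1 * u1" "x 1 = e1 * cnj u1"
    using polar_pair[of "x 4" "x 1"] n by auto
  obtain e2 u2 where p2: "cmod e2 = 1" "cmod u2 = 1" "x 2 = e2 * u2" "x 5 = e2 * cnj u2"
    using polar_pair[of "x 2" "x 5"] n by auto
  have sums: "x 0 + 1 * x 3 = of_real (2 * Re u0) * e0" "x 4 + 1 * x 1 = of_real (2 * Re u1) * e1"
    "x 2 + 1 * x 5 = of_real (2 * Re u2) * e2"
    by (simp_all add: p0 p1 p1(4)[unfolded One_nat_def] p2 complex_eq_iff algebra_simps)
  have diffs: "x 0 + - 1 * x 3 = \<i> * of_real (2 * Im u0) * e0" "x 4 + - 1 * x 1 = \<i> * of_real (2 * Im u1) * e1"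
    "x 2 + - 1 * x 5 = \<i> * of_real (2 * Im u2) * e2"
    by (simp_all add: p0 p1 p1(4)[unfolded One_nat_def] p2 complex_eq_iff algebra_simps)
  have "4 * (Re u1 * Re u0 * (e1 * cnj e0) + Re u2 * Re u1 * (e2 * cnj e1) + Re u0 * Re u2 * (e0 * cnj e2)) = 0"
    using biunimodular_flat(1)[OF x disjI1[OF refl]] unfolding sums by (simp add: algebra_simps)
  then have c: "Re u1 * Re u0 * (e1 * cnj e0) + Re u2 * Re u1 * (e2 * cnj e1) + Re u0 * Re u2 * (e0 * cnj e2) = 0"
    by (simp only: mult_eq_0_iff) simp
  have "4 * (Im u1 * Im u0 * (e1 * cnj e0) + Im u2 * Im u1 * (e2 * cnj e1) + Im u0 * Im u2 * (e0 * cnj e2)) = 0"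
    using biunimodular_flat(1)[OF x disjI2[OF refl]] unfolding diffs by (simp add: algebra_simps)
  then have s: "Im u1 * Im u0 * (e1 * cnj e0) + Im u2 * Im u1 * (e2 * cnj e1) + Im u0 * Im u2 * (e0 * cnj e2) = 0"
    by (simp only: mult_eq_0_iff) simp
  have m: "(Re u0)\<^sup>2 + (Re u1)\<^sup>2 + (Re u2)\<^sup>2 = 3 / 2"
    using biunimodular_flat(2)[OF x disjI1[OF refl]] p0(1) p1(1) p2(1) unfolding sums
    by (simp add: norm_mult power_mult_distrib)
  have un: "(Re u0)\<^sup>2 + (Im u0)\<^sup>2 = 1" "(Re u1)\<^sup>2 + (Im u1)\<^sup>2 = 1" "(Re u2)\<^sup>2 + (Im u2)\<^sup>2 = 1"
    using p0 p1 p2 by (auto simp: cmod_power2[symmetric])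
  have m': "(Im u0)\<^sup>2 + (Im u1)\<^sup>2 + (Im u2)\<^sup>2 = 3 / 2" using m un by simp
  have E: "cmod (e1 * cnj e0) = 1" "cmod (e2 * cnj e1) = 1" "cmod (e0 * cnj e2) = 1"
    using p0 p1 p2 by (simp_all add: norm_mult)
  have nz: "Re u0 \<noteq> 0 \<and> Re u1 \<noteq> 0 \<and> Re u2 \<noteq> 0"
  proof (rule relation_factors_nonzero[OF E])
    show "(Re u0)\<^sup>2 \<le> 1" "(Re u1)\<^sup>2 \<le> 1" "(Re u2)\<^sup>2 \<le> 1"
      using un zero_le_power2[of "Im u0"] zero_le_power2[of "Im u1"] zero_le_power2[of "Im u2"] by linarith+
  qed (use m c in simp_all)
  have nz': "Im u0 \<noteq> 0 \<and> Im u1 \<noteq> 0 \<and> Im u2 \<noteq> 0"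
  proof (rule relation_factors_nonzero[OF E])
    show "(Im u0)\<^sup>2 \<le> 1" "(Im u1)\<^sup>2 \<le> 1" "(Im u2)\<^sup>2 \<le> 1"
      using un zero_le_power2[of "Re u0"] zero_le_power2[of "Re u1"] zero_le_power2[of "Re u2"] by linarith+
  qed (use m' s in simp_all)
  \<comment> \<open>Divided by the product of the three Re u_b, or of the three Im u_b, the
    coefficients of a relation are the reciprocals of these numbers. So the two relations are
    proportional exactly when the Re u_b and the Im u_b are.\<close>
  show ?thesis
  proof (cases "Re u1 * Im u0 = Re u0 * Im u1 \<and> Re u2 * Im u0 = Re u0 * Im u2")
    case True
    then show ?thesis
      using product_vector_of_parallel[of e0 e1 e2 u0 u1 u2 x] p0 p1 p2 c m nz by blast
  next
    case False
    have c': "complex_of_real (Re u1 * Re u0) * (e1 * cnj e0) + complex_of_real (Re u2 * Re u1) * (e2 * cnj e1) + complex_of_real (Re u0 * Re u2) * (e0 * cnj e2) = 0"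
      using c by simp
    have s': "complex_of_real (Im u1 * Im u0) * (e1 * cnj e0) + complex_of_real (Im u2 * Im u1) * (e2 * cnj e1) + complex_of_real (Im u0 * Im u2) * (e0 * cnj e2) = 0"
      using s by simp
    have "(e2 * cnj e1 = e1 * cnj e0 \<or> e2 * cnj e1 = - (e1 * cnj e0)) \<and>
      (e0 * cnj e2 = e1 * cnj e0 \<or> e0 * cnj e2 = - (e1 * cnj e0))"
    proof (cases "Re u1 * Im u0 = Re u0 * Im u1")
      case False
      then have "(Re u2 * Re u1) * (Im u0 * Im u2) \<noteq> (Re u0 * Re u2) * (Im u2 * Im u1)"
        using nz nz' by (simp add: mult_ac)
      then show ?thesis by (rule collinear_phases[OF E c' s'])
    next
      case True
      with False have "Re u2 * Im u0 \<noteq> Re u0 * Im u2" by simp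
      then have "(Re u1 * Re u0) * (Im u2 * Im u1) \<noteq> (Re u2 * Re u1) * (Im u1 * Im u0)"
        using nz nz' by (simp add: mult_ac)
      note ne = this
      \<comment> \<open>The terms are rotated cyclically so that the nonvanishing minor becomes the
        one formed from the last two terms.\<close>
      have "complex_of_real (Re u0 * Re u2) * (e0 * cnj e2) + complex_of_real (Re u1 * Re u0) * (e1 * cnj e0) + complex_of_real (Re u2 * Re u1) * (e2 * cnj e1) = 0"
        "complex_of_real (Im u0 * Im u2) * (e0 * cnj e2) + complex_of_real (Im u1 * Im u0) * (e1 * cnj e0) + complex_of_real (Im u2 * Im u1) * (e2 * cnj e1) = 0"
        using c' s' by (simp_all only: add_ac)
      then have "(e1 * cnj e0 = e0 * cnj e2 \<or> e1 * cnj e0 = - (e0 * cnj e2)) \<and>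
        (e2 * cnj e1 = e0 * cnj e2 \<or> e2 * cnj e1 = - (e0 * cnj e2))"
        using ne by (rule collinear_phases[OF E(3,1,2)])
      then show ?thesis by auto
    qed
    then consider "e2 * cnj e1 = e1 * cnj e0" "e0 * cnj e2 = e1 * cnj e0"
      | "e2 * cnj e1 = e1 * cnj e0" "e0 * cnj e2 = - (e1 * cnj e0)"
      | "e2 * cnj e1 = - (e1 * cnj e0)" "e0 * cnj e2 = e1 * cnj e0"
      | "e2 * cnj e1 = - (e1 * cnj e0)" "e0 * cnj e2 = - (e1 * cnj e0)" by blast
    \<comment> \<open>Replacing (e_b, u_b) by (-e_b, -u_b) leaves x unchanged and flips the two
      ratios that involve e_b. At most one such flip makes all three ratios equal.\<close>
    then have "\<exists>d\<in>{1, -1}. skew_vector d x"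
    proof cases
      case 1
      then show ?thesis by (intro skew_vector_of_equal_phases[of e0 e1 e2 u0 u1 u2 x]) (use p0 p1 p2 c s m in simp_all)
    next
      case 2
      then show ?thesis by (intro skew_vector_of_equal_phases[of e0 "- e1" e2 u0 "- u1" u2 x]) (use p0 p1 p2 c s m in simp_all)
    next
      case 3
      then show ?thesis by (intro skew_vector_of_equal_phases[of "- e0" e1 e2 "- u0" u1 u2 x]) (use p0 p1 p2 c s m in simp_all)
    next
      case 4
      then show ?thesis by (intro skew_vector_of_equal_phases[of e0 e1 "- e2" u0 u1 "- u2" x]) (use p0 p1 p2 c s m in simp_all)
    qed
    then show ?thesis by blast
  qed
qed

section \<open>Overlaps of biunimodular sequences\<close>

text \<open>For each b the odd entry repeats the contribution of the even one with
  \<open>v b * cnj (v' b)\<close> conjugated and with the sign d d'. For signs d and d' the bracket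
  is thus twice a real part or 2 i times an imaginary part.\<close>

lemma crt_vector_overlap:
  "(\<Sum>j<6. crt_vector d g e v j * cnj (crt_vector d' g' e' v' j)) =
     g * cnj g' * (\<Sum>b<3. e b * cnj (e' b) * (v b * cnj (v' b) + of_real (d * d') * cnj (v b * cnj (v' b))))"
  by (simp add: lessThan_6 lessThan_nat_numeral lessThan_Suc crt_vector_def algebra_simps)

lemma cmod_phase_sum_sq:
  fixes r :: "nat \<Rightarrow> real" and h :: "nat \<Rightarrow> complex"
  assumes "\<forall>b. cmod (h b) = 1"
  shows "(cmod (\<Sum>b<3. h b * r b))\<^sup>2 = (r 0)\<^sup>2 + (r 1)\<^sup>2 + (r 2)\<^sup>2 + 2 * Re (h 0 * cnj (h 1)) * (r 0 * r 1)
     + 2 * Re (h 1 * cnj (h 2)) * (r 1 * r 2) + 2 * Re (h 0 * cnj (h 2)) * (r 0 * r 2)"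
proof -
  have n: "(Re (h b))\<^sup>2 + (Im (h b))\<^sup>2 = 1" for b
    using assms by (simp add: cmod_power2[symmetric])
  have S: "(\<Sum>b<3. h b * r b) = h 0 * r 0 + h 1 * r 1 + h 2 * r 2"
    by (simp add: lessThan_nat_numeral lessThan_Suc algebra_simps)
  have "(cmod (\<Sum>b<3. h b * r b))\<^sup>2 = ((Re (h 0))\<^sup>2 + (Im (h 0))\<^sup>2) * (r 0)\<^sup>2
     + ((Re (h 1))\<^sup>2 + (Im (h 1))\<^sup>2) * (r 1)\<^sup>2 + ((Re (h 2))\<^sup>2 + (Im (h 2))\<^sup>2) * (r 2)\<^sup>2
     + 2 * Re (h 0 * cnj (h 1)) * (r 0 * r 1)
     + 2 * Re (h 1 * cnj (h 2)) * (r 1 * r 2) + 2 * Re (h 0 * cnj (h 2)) * (r 0 * r 2)"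
    unfolding S cmod_power2 by (simp add: power2_eq_square algebra_simps)
  then show ?thesis unfolding n by simp
qed

text \<open>For signs d and d', the bracket of \<open>crt_vector_overlap\<close> without the factor
  i that it carries when they differ.\<close>

definition real_overlap :: "real \<Rightarrow> real \<Rightarrow> complex \<Rightarrow> complex \<Rightarrow> real" where
  "real_overlap d d' v v' = (if d = d' then 2 * Re (v * cnj v') else 2 * Im (v * cnj v'))"

lemma crt_vector_overlap_sq:
  assumes d: "d \<in> {1, -1}" "d' \<in> {1, -1}" and g: "cmod g = 1" "cmod g' = 1"
    and e: "\<forall>b. cmod (e b) = 1" "\<forall>b. cmod (e' b) = 1"
    and x: "\<forall>j<6. x j = crt_vector d g e v j" "\<forall>j<6. x' j = crt_vector d' g' e' v' j"
    and h_def: "\<And>b. h b = e b * cnj (e' b)" and r_def: "\<And>b. r b = real_overlap d d' (v b) (v' b)"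
  shows "(cmod (\<Sum>j<6. x j * cnj (x' j)))\<^sup>2 =
     (r 0)\<^sup>2 + (r 1)\<^sup>2 + (r 2)\<^sup>2 + 2 * Re (h 0 * cnj (h 1)) * (r 0 * r 1)
     + 2 * Re (h 1 * cnj (h 2)) * (r 1 * r 2) + 2 * Re (h 0 * cnj (h 2)) * (r 0 * r 2)"
proof -
  define s :: complex where "s = (if d = d' then 1 else \<i>)"
  have "(v b * cnj (v' b) + of_real (d * d') * cnj (v b * cnj (v' b))) = s * r b" for b
    using d by (auto simp: s_def r_def real_overlap_def complex_eq_iff)
  then have "(\<Sum>j<6. x j * cnj (x' j)) = g * cnj g' * (\<Sum>b<3. h b * (s * r b))"
    using x by (simp add: crt_vector_overlap h_def)
  also have "\<dots> = g * cnj g' * s * (\<Sum>b<3. h b * r b)"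
    by (simp add: sum_distrib_left mult_ac)
  finally have "cmod (\<Sum>j<6. x j * cnj (x' j)) = cmod (\<Sum>b<3. h b * r b)"
    using g by (simp add: norm_mult s_def)
  then show ?thesis using cmod_phase_sum_sq[of h r] e by (simp add: h_def norm_mult)
qed

lemma cube_root_norm:
  assumes "w ^ 3 = (1 :: complex)"
  shows "cmod w = 1"
proof -
  have "cmod w ^ 3 = 1 ^ 3" using assms by (metis norm_one norm_power power_one)
  then show ?thesis by (rule power_eq_imp_eq_base) simp_all
qed

lemma cube_root_cases:
  assumes "w ^ 3 = (1 :: complex)"
  shows "2 * Re w = 2 \<or> 2 * Re w = - 1"
proof (cases "w = 1")
  case False
  have n: "w * cnj w = 1" by (rule cnj_unit_mult[OF cube_root_norm[OF assms]])
  have "(w - 1) * (w ^ 2 + w + 1) = w ^ 3 - 1" by (simp add: power2_eq_square power3_eq_cube algebra_simps)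
  then have "w ^ 2 + w + 1 = 0" using False assms by simp
  then have "cnj w * (w ^ 2 + w + 1) = 0" by simp
  moreover have "cnj w * (w ^ 2 + w + 1) = w * (w * cnj w) + w * cnj w + cnj w"
    by (simp add: power2_eq_square algebra_simps)
  ultimately have "w + 1 + cnj w = 0" using n by simp
  then have "Re (w + 1 + cnj w) = 0" by simp
  then show ?thesis by simp
qed simp

text \<open>The three real overlaps are all 2 or all 0, and the cross terms carry factors 2 or -1;
  so the value is a multiple of 12.\<close>

lemma product_product_overlap:
  assumes d: "d \<in> {1, -1}" "d' \<in> {1, -1}" and "product_vector d x" "product_vector d' x'"
  shows "(cmod (\<Sum>j<6. x j * cnj (x' j)))\<^sup>2 \<noteq> 6"
proof -
  obtain g e where x: "cmod g = 1" "\<forall>b. e b ^ 3 = 1" "\<forall>j<6. x j = crt_vector d g e (\<lambda>_. 1) j"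
    using assms(3) by (auto simp: product_vector_def)
  obtain g' e' where x': "cmod g' = 1" "\<forall>b. e' b ^ 3 = 1" "\<forall>j<6. x' j = crt_vector d' g' e' (\<lambda>_. 1) j"
    using assms(4) by (auto simp: product_vector_def)
  define h where "h = (\<lambda>b. e b * cnj (e' b))"
  then have hb: "h b = e b * cnj (e' b)" for b by simp
  have n: "\<forall>b. cmod (e b) = 1" "\<forall>b. cmod (e' b) = 1" using x x' cube_root_norm by auto
  have "(h a * cnj (h b)) ^ 3 = (e a ^ 3) * cnj (e' a ^ 3) * cnj (e b ^ 3) * e' b ^ 3" for a b
    by (simp add: h_def power_mult_distrib)
  then have "2 * Re (h a * cnj (h b)) = 2 \<or> 2 * Re (h a * cnj (h b)) = - 1" for a b
    using x x' by (intro cube_root_cases) simp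
  note r = this
  show ?thesis
    unfolding crt_vector_overlap_sq[where h = h, OF d x(1) x'(1) n x(3) x'(3) hb refl]
    using r[of 0 1] r[of 1 2] r[of 0 2]
    by (elim disjE) (simp_all add: real_overlap_def)
qed

lemma skew_tripleE:
  assumes "skew_triple u v w"
  obtains t where "t\<^sup>2 = sqrt 3 / 2"
    "(u, v, w) \<in> {(1, Complex ((sqrt 3 - 1) / 2) t, Complex ((sqrt 3 - 1) / 2) (- t)),
       (Complex ((sqrt 3 - 1) / 2) t, 1, Complex ((sqrt 3 - 1) / 2) (- t)),
       (Complex ((sqrt 3 - 1) / 2) t, Complex ((sqrt 3 - 1) / 2) (- t), 1)}"
proof -
  obtain z where z: "cmod z = 1" "2 * Re z = sqrt 3 - 1" "(u, v, w) \<in> {(1, z, cnj z), (z, 1, cnj z), (z, cnj z, 1)}"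
    using assms by (auto simp: skew_triple_def)
  have "(Re z)\<^sup>2 + (Im z)\<^sup>2 = 1" using z(1) by (simp add: cmod_power2[symmetric])
  moreover have r: "Re z = (sqrt 3 - 1) / 2" using z(2) by simp
  ultimately have "(Im z)\<^sup>2 = sqrt 3 / 2" by (simp add: power2_eq_square field_simps)
  moreover have "z = Complex ((sqrt 3 - 1) / 2) (Im z)" "cnj z = Complex ((sqrt 3 - 1) / 2) (- Im z)"
    using r by (simp_all add: complex_eq_iff)
  ultimately show ?thesis using that[of "Im z"] z(3) by auto
qed

text \<open>Precise enough to separate from 6 the overlaps computed below; the closest of them is 24
  sqrt 3 - 36, about 5.57.\<close>

lemma sqrt_3_bounds: "173 / 100 < sqrt 3" "sqrt 3 < 1733 / 1000"
  by (rule real_less_rsqrt, simp add: power2_eq_square) (rule real_less_lsqrt, auto simp: power2_eq_square)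

text \<open>For different signs the entry 1 of the skew triple has real overlap 0, while z and cnj z
  have opposite ones with square 2 sqrt 3. So the value is 0 or 6 sqrt 3. For equal signs the value
  6 does occur.\<close>

lemma product_skew_overlap:
  assumes d: "d \<in> {1, -1}" "d' \<in> {1, -1}" "d \<noteq> d'" and "product_vector d x" "skew_vector d' x'"
  shows "(cmod (\<Sum>j<6. x j * cnj (x' j)))\<^sup>2 \<noteq> 6"
proof -
  obtain g e where x: "cmod g = 1" "\<forall>b. e b ^ 3 = 1" "\<forall>j<6. x j = crt_vector d g e (\<lambda>_. 1) j"
    using assms by (auto simp: product_vector_def)
  obtain g' c v where x': "cmod g' = 1" "c ^ 3 = 1" "skew_triple (v 0) (v 1) (v 2)"
      "\<forall>j<6. x' j = crt_vector d' g' (\<lambda>b. c ^ b) v j"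
    using assms by (auto simp: skew_vector_def)
  define h where "h = (\<lambda>b. e b * cnj (c ^ b))"
  then have hb: "h b = e b * cnj (c ^ b)" for b by simp
  have n: "\<forall>b. cmod (e b) = 1" "\<forall>b. cmod (c ^ b) = 1" using x x' cube_root_norm by (auto simp: norm_power)
  have "(h a * cnj (h b)) ^ 3 = (e a ^ 3) * cnj ((c ^ 3) ^ a) * cnj (e b ^ 3) * (c ^ 3) ^ b" for a b
    by (simp add: h_def power_mult_distrib mult.commute flip: power_mult)
  then have r: "2 * Re (h a * cnj (h b)) = 2 \<or> 2 * Re (h a * cnj (h b)) = - 1" for a b
    using x x' by (intro cube_root_cases) simp
  obtain t where t: "t\<^sup>2 = sqrt 3 / 2" and
    "(v 0, v 1, v 2) \<in> {(1, Complex ((sqrt 3 - 1) / 2) t, Complex ((sqrt 3 - 1) / 2) (- t)),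
       (Complex ((sqrt 3 - 1) / 2) t, 1, Complex ((sqrt 3 - 1) / 2) (- t)),
       (Complex ((sqrt 3 - 1) / 2) t, Complex ((sqrt 3 - 1) / 2) (- t), 1)}"
    using skew_tripleE[OF x'(3)] .
  moreover have "t * t = sqrt 3 / 2" using t by (simp add: power2_eq_square)
  ultimately show ?thesis
    unfolding crt_vector_overlap_sq[where h = h, OF d(1,2) x(1) x'(1) n x(3) x'(4) hb refl]
    using r[of 0 1] r[of 1 2] r[of 0 2] sqrt_3_bounds d(3)
    by (auto simp: real_overlap_def power2_eq_square)
qed

text \<open>The phases are powers of one cube root of unity w, so all cross terms carry the same
  factor 2 Re w, which is 2 or -1. What remains is a finite table of the sum of squares N and the
  sum of products M of the real overlaps.\<close>

lemma skew_skew_overlap: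
  assumes d: "d \<in> {1, -1}" "d' \<in> {1, -1}" and "skew_vector d x" "skew_vector d' x'"
  shows "(cmod (\<Sum>j<6. x j * cnj (x' j)))\<^sup>2 \<noteq> 6"
proof -
  obtain g c v where x: "cmod g = 1" "c ^ 3 = 1" "skew_triple (v 0) (v 1) (v 2)"
      "\<forall>j<6. x j = crt_vector d g (\<lambda>b. c ^ b) v j"
    using assms by (auto simp: skew_vector_def)
  obtain g' c' v' where x': "cmod g' = 1" "c' ^ 3 = 1" "skew_triple (v' 0) (v' 1) (v' 2)"
      "\<forall>j<6. x' j = crt_vector d' g' (\<lambda>b. c' ^ b) v' j"
    using assms by (auto simp: skew_vector_def)
  define r where "r = (\<lambda>b. real_overlap d d' (v b) (v' b))"
  then have rb: "r b = real_overlap d d' (v b) (v' b)" for b by simp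
  define h where "h = (\<lambda>b. c ^ b * cnj (c' ^ b))"
  then have hb: "h b = c ^ b * cnj (c' ^ b)" for b by simp
  define w where "w = c * cnj c'"
  define q where "q = sqrt 3"
  have n: "\<forall>b. cmod (c ^ b) = 1" "\<forall>b. cmod (c' ^ b) = 1" using x x' cube_root_norm by (auto simp: norm_power)
  have hw: "h b = w ^ b" for b by (simp add: h_def w_def power_mult_distrib)
  have w3: "w ^ 3 = (c ^ 3) * cnj (c' ^ 3)" by (simp add: w_def power_mult_distrib)
  then have w3: "w ^ 3 = 1" unfolding x x' by simp
  have ww: "w * cnj w = 1" by (rule cnj_unit_mult[OF cube_root_norm[OF w3]])
  have "w * cnj (w\<^sup>2) = (w * cnj w) * cnj w" by (simp add: power2_eq_square mult_ac)
  moreover have "cnj (w\<^sup>2) = w"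
  proof -
    have "cnj (w\<^sup>2) = w ^ 3 * cnj (w\<^sup>2)" using w3 by simp
    also have "\<dots> = w * ((w * cnj w) * (w * cnj w))"
      by (simp add: power2_eq_square power3_eq_cube mult_ac)
    finally show ?thesis using ww by simp
  qed
  ultimately have Reh: "Re (h 0 * cnj (h 1)) = Re w" "Re (h 1 * cnj (h 2)) = Re w" "Re (h 0 * cnj (h 2)) = Re w"
    unfolding hw by (simp_all add: ww power_one_right del: complex_cnj_power)
  define \<alpha> where "\<alpha> = 2 * Re w"
  have \<alpha>: "\<alpha> = 2 \<or> \<alpha> = - 1" unfolding \<alpha>_def by (rule cube_root_cases[OF w3])
  have val: "(cmod (\<Sum>j<6. x j * cnj (x' j)))\<^sup>2 =
     (r 0)\<^sup>2 + (r 1)\<^sup>2 + (r 2)\<^sup>2 + \<alpha> * (r 0 * r 1) + \<alpha> * (r 1 * r 2) + \<alpha> * (r 0 * r 2)"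
    unfolding crt_vector_overlap_sq[where h = h and r = r, OF d(1,2) x(1) x'(1) n x(4) x'(4) hb rb] Reh \<alpha>_def ..
  obtain t where t: "t\<^sup>2 = sqrt 3 / 2" and v:
    "(v 0, v 1, v 2) \<in> {(1, Complex ((sqrt 3 - 1) / 2) t, Complex ((sqrt 3 - 1) / 2) (- t)),
       (Complex ((sqrt 3 - 1) / 2) t, 1, Complex ((sqrt 3 - 1) / 2) (- t)),
       (Complex ((sqrt 3 - 1) / 2) t, Complex ((sqrt 3 - 1) / 2) (- t), 1)}"
    using skew_tripleE[OF x(3)] .
  obtain t' where t': "t'\<^sup>2 = sqrt 3 / 2" and v':
    "(v' 0, v' 1, v' 2) \<in> {(1, Complex ((sqrt 3 - 1) / 2) t', Complex ((sqrt 3 - 1) / 2) (- t')),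
       (Complex ((sqrt 3 - 1) / 2) t', 1, Complex ((sqrt 3 - 1) / 2) (- t')),
       (Complex ((sqrt 3 - 1) / 2) t', Complex ((sqrt 3 - 1) / 2) (- t'), 1)}"
    using skew_tripleE[OF x'(3)] .
  have "t'\<^sup>2 = t\<^sup>2" using t t' by simp
  then have tt': "t' = t \<or> t' = - t" by (simp only: power2_eq_iff)
  have tt: "t * t = q / 2" "\<And>y. t * (t * y) = q / 2 * y" using t by (simp_all add: q_def power2_eq_square mult.assoc[symmetric])
  have qq: "q * q = 3" "\<And>y. q * (q * y) = 3 * y" by (simp_all add: q_def mult.assoc[symmetric])
  have q: "173 / 100 < q" "q < 1733 / 1000" using sqrt_3_bounds by (simp_all add: q_def)
  let ?z = "Complex ((q - 1) / 2) t"
  have cz: "cnj ?z = Complex ((q - 1) / 2) (- t)" by (simp add: complex_eq_iff)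
  have vals: "(v 0, v 1, v 2) \<in> {(1, ?z, cnj ?z), (?z, 1, cnj ?z), (?z, cnj ?z, 1)}"
    using v unfolding cz unfolding q_def .
  \<comment> \<open>Both triples are expressed through the same z; the case t' = -t accounts for the
    last three orders.\<close>
  have vals': "(v' 0, v' 1, v' 2) \<in> {(1, ?z, cnj ?z), (?z, 1, cnj ?z), (?z, cnj ?z, 1), (1, cnj ?z, ?z), (cnj ?z, 1, ?z), (cnj ?z, ?z, 1)}"
    using tt' v' unfolding cz unfolding q_def by (elim disjE) (simp_all only:, auto)
  define N where "N = (r 0)\<^sup>2 + (r 1)\<^sup>2 + (r 2)\<^sup>2"
  define M where "M = r 0 * r 1 + r 1 * r 2 + r 0 * r 2"
  have val': "(cmod (\<Sum>j<6. x j * cnj (x' j)))\<^sup>2 = N + \<alpha> * M"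
    unfolding val by (simp add: N_def M_def algebra_simps)
  \<comment> \<open>Four pairs for equal signs and four for different ones: the second triple equals
    the first, or arises from it by exchanging z with cnj z, by exchanging 1 with one of them, or by
    a cyclic permutation.\<close>
  have "(N, M) \<in> {(12, 12), (36 - 16 * q, 24 - 16 * q), (12 - 4 * q, 2 * q), (24 - 12 * q, 6 * q - 12),
      (0, 0), (16 * q - 24, 12 - 8 * q), (4 * q, - 2 * q), (12 * q - 12, 6 * q - 12)}"
  proof (cases "d = d'")
    case True
    have tab: "real_overlap d d' 1 1 = 2" "real_overlap d d' ?z ?z = 2" "real_overlap d d' (cnj ?z) (cnj ?z) = 2"
      "real_overlap d d' 1 ?z = q - 1" "real_overlap d d' 1 (cnj ?z) = q - 1"
      "real_overlap d d' ?z 1 = q - 1" "real_overlap d d' (cnj ?z) 1 = q - 1"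
      "real_overlap d d' ?z (cnj ?z) = 2 - 2 * q" "real_overlap d d' (cnj ?z) ?z = 2 - 2 * q"
      using True by (simp_all add: real_overlap_def field_simps tt qq)
    show ?thesis
      using vals vals' unfolding N_def M_def rb insert_iff empty_iff prod.inject simp_thms
      by (elim disjE conjE) (simp_all add: tab power2_eq_square algebra_simps qq del: complex_cnj)
  next
    case False
    have tab: "real_overlap d d' 1 1 = 0" "real_overlap d d' ?z ?z = 0" "real_overlap d d' (cnj ?z) (cnj ?z) = 0"
      "real_overlap d d' 1 ?z = - 2 * t" "real_overlap d d' 1 (cnj ?z) = 2 * t"
      "real_overlap d d' ?z 1 = 2 * t" "real_overlap d d' (cnj ?z) 1 = - 2 * t"
      "real_overlap d d' ?z (cnj ?z) = (2 * q - 2) * t" "real_overlap d d' (cnj ?z) ?z = (2 - 2 * q) * t"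
      using False by (simp_all add: real_overlap_def field_simps)
    show ?thesis
      using vals vals' unfolding N_def M_def rb insert_iff empty_iff prod.inject simp_thms
      by (elim disjE conjE) (simp_all add: tab power2_eq_square algebra_simps tt qq del: complex_cnj)
  qed
  then show ?thesis unfolding val' using \<alpha> q by auto
qed

section \<open>Weyl matrices\<close>

text \<open>The matrix omega6^c X^a Z^b. The exponents are natural numbers that matter only modulo
  6, with multiplication by 5 in the role of negation.\<close>

definition weyl :: "nat \<Rightarrow> nat \<Rightarrow> nat \<Rightarrow> complex mat" where
  "weyl a b c = Matrix.mat 6 6 (\<lambda>(i, j). if i = (j + a) mod 6 then omega6 ^ (c + b * j) else 0)"

lemma weyl_carrier [simp]: "weyl a b c \<in> carrier_mat 6 6"
  by (simp add: weyl_def)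

lemma omega6_power_cong: "m mod 6 = n mod 6 \<Longrightarrow> omega6 ^ m = omega6 ^ n"
  by (metis omega6_power_mod)

lemma omega6_power_eq_iff: "omega6 ^ m = omega6 ^ n \<longleftrightarrow> m mod 6 = n mod 6"
proof
  have less: "m mod 6 = 0 \<or> m mod 6 = 1 \<or> m mod 6 = 2 \<or> m mod 6 = 3 \<or> m mod 6 = 4 \<or> m mod 6 = 5" for m :: nat
    by presburger
  have val: "omega6 ^ 0 = Complex 1 0" "omega6 ^ 1 = Complex (1/2) (sqrt 3 / 2)"
    "omega6 ^ 2 = Complex (- 1/2) (sqrt 3 / 2)" "omega6 ^ 3 = Complex (- 1) 0"
    "omega6 ^ 4 = Complex (- 1/2) (- sqrt 3 / 2)" "omega6 ^ 5 = Complex (1/2) (- sqrt 3 / 2)"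
    unfolding omega6_powers omega6_cube omega6_sq by (simp_all add: omega6_eq complex_eq_iff)
  assume "omega6 ^ m = omega6 ^ n"
  then have "omega6 ^ (m mod 6) = omega6 ^ (n mod 6)" by (simp flip: omega6_power_mod)
  then show "m mod 6 = n mod 6"
    using less[of m] less[of n] by (elim disjE) (simp_all only: val complex.inject, simp_all)
qed (rule omega6_power_cong)

lemma weyl_cong:
  assumes "a mod 6 = a' mod 6" "b mod 6 = b' mod 6" "c mod 6 = c' mod 6"
  shows "weyl a b c = weyl a' b' c'"
proof -
  have "(j + a) mod 6 = (j + a') mod 6" for j using assms(1) by (metis mod_add_right_eq)
  moreover have "omega6 ^ (c + b * j) = omega6 ^ (c' + b' * j)" for j
    by (rule omega6_power_cong) (metis assms(2,3) mod_add_eq mod_mult_left_eq)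
  ultimately show ?thesis unfolding weyl_def by (intro cong_mat) simp_all
qed

lemma weyl_mult: "weyl a b c * weyl a' b' c' = weyl (a + a') (b + b') (c + c' + b * a')"
proof (rule eq_matI)
  fix i j assume "i < dim_row (weyl (a + a') (b + b') (c + c' + b * a'))"
    and "j < dim_col (weyl (a + a') (b + b') (c + c' + b * a'))"
  then have ij: "i < 6" "j < 6" by (auto simp: weyl_def)
  let ?k = "(j + a') mod 6"
  have "(weyl a b c * weyl a' b' c') $$ (i, j) =
      (\<Sum>k\<in>{0..<6}. (if i = (k + a) mod 6 then omega6 ^ (c + b * k) else 0) *
         (if k = ?k then omega6 ^ (c' + b' * j) else 0))"
    using ij by (simp add: weyl_def scalar_prod_def)
  also have "\<dots> = (if i = (?k + a) mod 6 then omega6 ^ (c + b * ?k) else 0) * omega6 ^ (c' + b' * j)"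
    by (subst sum.remove[of _ ?k]) simp_all
  also have "(?k + a) mod 6 = (j + (a + a')) mod 6" by (metis mod_add_left_eq add.assoc add.commute)
  also have "omega6 ^ (c + b * ?k) = omega6 ^ (c + b * (j + a'))"
    by (rule omega6_power_cong) (metis mod_add_right_eq mod_mult_right_eq)
  finally show "(weyl a b c * weyl a' b' c') $$ (i, j) = weyl (a + a') (b + b') (c + c' + b * a') $$ (i, j)"
    using ij by (simp add: weyl_def algebra_simps flip: power_add)
qed (simp_all add: weyl_def)

lemma weyl_scalar: "weyl 0 0 c = omega6 ^ c \<cdot>\<^sub>m 1\<^sub>m 6"
  by (rule eq_matI) (auto simp: weyl_def)

lemma weyl_0: "weyl 0 0 0 = 1\<^sub>m 6"
  by (rule eq_matI) (auto simp: weyl_def)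

lemma X6_weyl: "X6 = weyl 1 0 0"
  by (rule eq_matI) (auto simp: X6_def weyl_def)

lemma Z6_weyl: "Z6 = weyl 0 1 0"
  by (rule eq_matI) (auto simp: Z6_def weyl_def mat_diag_def)

lemma weyl_inverse:
  "weyl a b c * weyl (5 * a) (5 * b) (5 * c + a * b) = 1\<^sub>m 6"
  "weyl (5 * a) (5 * b) (5 * c + a * b) * weyl a b c = 1\<^sub>m 6"
  unfolding weyl_mult by (subst weyl_0[symmetric], rule weyl_cong; simp add: algebra_simps)+

lemma GL6_simps: "monoid.mult GL6 = (*)" "monoid.one GL6 = 1\<^sub>m 6"
  by (simp_all add: GL6_def units_of_mult units_of_one ring_mat_simps)

lemma group_GL6: "group GL6"
proof -
  interpret ring "ring_mat TYPE(complex) 6 ()" by (rule ring_mat)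
  show ?thesis unfolding GL6_def by (rule units_group)
qed

lemma weyl_GL6: "weyl a b c \<in> carrier GL6"
  unfolding GL6_def units_of_carrier Units_def ring_mat_simps
  using weyl_inverse[of a b c] by (auto intro!: bexI[of _ "weyl (5 * a) (5 * b) (5 * c + a * b)"])

lemma inv_weyl: "inv\<^bsub>GL6\<^esub> (weyl a b c) = weyl (5 * a) (5 * b) (5 * c + a * b)"
  by (rule group.inv_equality[OF group_GL6]) (simp_all add: weyl_GL6 GL6_simps weyl_inverse)

lemma H6_weyl:
  assumes "M \<in> H6"
  obtains a b c where "M = weyl a b c"
proof -
  from assms have "\<exists>a b c. M = weyl a b c" unfolding H6_def
  proof (induction rule: generate.induct)
    case one
    show ?case unfolding GL6_simps weyl_0[symmetric] by blast
  next
    case (incl h)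
    then have "h = weyl 1 0 0 \<or> h = weyl 0 1 0" by (simp add: X6_weyl Z6_weyl)
    then show ?case by blast
  next
    case (inv h)
    then have "h = weyl 1 0 0 \<or> h = weyl 0 1 0" by (simp add: X6_weyl Z6_weyl)
    then show ?case using inv_weyl by blast
  next
    case (eng g h)
    then show ?case unfolding GL6_simps using weyl_mult by metis
  qed
  then show ?thesis using that by blast
qed

lemma H6_mult: "M \<in> H6 \<Longrightarrow> N \<in> H6 \<Longrightarrow> M * N \<in> H6"
  using generate.eng[of M GL6 "{X6, Z6}" N] by (simp add: H6_def GL6_simps)

lemma smult_mat_mult_vec:
  fixes A :: "complex mat"
  assumes "A \<in> carrier_mat nr nc" "v \<in> carrier_vec nc"
  shows "(k \<cdot>\<^sub>m A) *\<^sub>v v = k \<cdot>\<^sub>v (A *\<^sub>v v)"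
  using assms by (intro eq_vecI) (auto simp: scalar_prod_def sum_distrib_left mult_ac)

lemma pow_generate:
  assumes "A \<in> generate GL6 S" "A \<in> carrier_mat 6 6"
  shows "A ^\<^sub>m n \<in> generate GL6 S"
proof (induction n)
  case 0
  then show ?case using assms(2) generate.one[of GL6 S] by (simp add: GL6_simps)
next
  case (Suc n)
  then show ?case using generate.eng[OF _ assms(1), of "A ^\<^sub>m n"] by (simp add: GL6_simps)
qed

lemma weyl_pow: "\<exists>c'. weyl a b c ^\<^sub>m n = weyl (n * a) (n * b) c'"
proof (induction n)
  case 0
  have "weyl a b c ^\<^sub>m 0 = weyl (0 * a) (0 * b) 0"
    using carrier_matD(1)[OF weyl_carrier] by (simp add: weyl_0)
  then show ?case by blast
next
  case (Suc n)
  then obtain c' where "weyl a b c ^\<^sub>m n = weyl (n * a) (n * b) c'" by blast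
  then have "weyl a b c ^\<^sub>m Suc n = weyl (Suc n * a) (Suc n * b) (c' + c + n * b * a)"
    by (simp add: weyl_mult add.commute)
  then show ?case by blast
qed

section \<open>Non-degeneracy and the commutation phase\<close>

text \<open>If p divides a and b, the power with exponent n = 6 / p is scalar. Every eigenvalue is
  then an n-th root of one fixed number, and there are only n < 6 of these.\<close>

lemma nondegenerate_weyl:
  assumes nd: "nondegenerate (weyl a b c)" and p: "p = 2 \<or> p = 3" and "p dvd a" "p dvd b"
  shows False
proof -
  define n where "n = 6 div p"
  have n: "0 < n" "n < 6" "n * p = 6" using p by (auto simp: n_def)
  obtain c' where c': "weyl a b c ^\<^sub>m n = weyl (n * a) (n * b) c'" using weyl_pow by blast
  have "6 dvd n * a" "6 dvd n * b" using assms(3,4) n(3) by (metis mult_dvd_mono dvd_refl)+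
  then have "weyl a b c ^\<^sub>m n = weyl 0 0 c'" unfolding c' by (intro weyl_cong) auto
  then have pw: "weyl a b c ^\<^sub>m n = omega6 ^ c' \<cdot>\<^sub>m 1\<^sub>m 6" by (simp add: weyl_scalar)
  have "{k. eigenvalue (weyl a b c) k} \<subseteq> {z. z ^ n = omega6 ^ c'}"
  proof
    fix k assume "k \<in> {k. eigenvalue (weyl a b c) k}"
    then obtain v where v: "eigenvector (weyl a b c) v k" by (auto simp: eigenvalue_def)
    then have vc: "v \<in> carrier_vec 6" "v \<noteq> 0\<^sub>v 6" by (auto simp: eigenvector_def weyl_def)
    have "k ^ n \<cdot>\<^sub>v v = omega6 ^ c' \<cdot>\<^sub>v v"
      using eigenvector_pow[OF weyl_carrier v, of n] vc(1) unfolding pw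
      by (simp add: smult_mat_mult_vec[OF one_carrier_mat])
    then have "\<forall>i<6. (k ^ n - omega6 ^ c') * v $ i = 0"
      using vc by (auto simp: vec_eq_iff algebra_simps)
    moreover have "\<exists>i<6. v $ i \<noteq> 0" using vc by (auto simp: vec_eq_iff)
    ultimately show "k \<in> {z. z ^ n = omega6 ^ c'}" by auto
  qed
  moreover have "card {z. z ^ n = omega6 ^ c'} = n"
    using n cmod_omega6 by (intro card_nth_roots) auto
  moreover have "finite {z. z ^ n = omega6 ^ c'}"
    using calculation(2) n by (intro card_ge_0_finite) simp
  ultimately have "card {k. eigenvalue (weyl a b c) k} \<le> n" by (metis card_mono)
  then show False using nd n by (simp add: nondegenerate_def)
qed

lemma mod_add_left_cancel_nat: "(k + x) mod n = (k + y) mod n \<longleftrightarrow> x mod n = y mod (n :: nat)"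
  unfolding nat_mod_eq_iff by (simp add: add.assoc)

lemma weyl_commutes_iff: "weyl a b c * weyl a' b' c' = weyl a' b' c' * weyl a b c \<longleftrightarrow> (b * a') mod 6 = (b' * a) mod 6"
proof -
  have eq: "weyl a b c = weyl a b c' \<longleftrightarrow> c mod 6 = c' mod 6" for a b c c'
  proof
    assume "weyl a b c = weyl a b c'"
    then have "weyl a b c $$ (a mod 6, 0) = weyl a b c' $$ (a mod 6, 0)" by simp
    then show "c mod 6 = c' mod 6" by (simp add: weyl_def omega6_power_eq_iff)
  qed (rule weyl_cong, simp_all)
  have "weyl a b c * weyl a' b' c' = weyl (a + a') (b + b') (c + c' + b * a')"
    "weyl a' b' c' * weyl a b c = weyl (a + a') (b + b') (c + c' + b' * a)"
    unfolding weyl_mult by (simp_all add: add_ac)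
  then show ?thesis by (simp only: eq mod_add_left_cancel_nat)
qed


lemma mod_eq_of_dvd_add_5:
  fixes p x y :: nat
  assumes "p = 2 \<or> p = 3" "p dvd x + 5 * y"
  shows "x mod p = y mod p"
proof -
  obtain q where q: "x + 5 * y = p * q" using assms(2) by (auto elim: dvdE)
  have "p = 2 \<Longrightarrow> x + p * (3 * y) = y + p * q" "p = 3 \<Longrightarrow> x + p * (2 * y) = y + p * q"
    unfolding q[symmetric] by simp_all
  then show ?thesis unfolding nat_mod_eq_iff using assms(1) by blast
qed

text \<open>Every unit modulo 2 or 3 is its own inverse, and 5 stands for -1.\<close>

lemma dvd_square_add_5:
  fixes p a :: nat
  assumes p: "p = 2 \<or> p = 3" and "\<not> p dvd a"
  shows "p dvd a * a + 5"
proof -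
  have "p = 2 \<and> a mod p = 1 \<or> p = 3 \<and> (a mod p = 1 \<or> a mod p = 2)"
  proof -
    have "\<not> 2 dvd a \<longrightarrow> a mod 2 = 1" "\<not> 3 dvd a \<longrightarrow> a mod 3 = 1 \<or> a mod 3 = 2"
      by presburger+
    then show ?thesis using assms by blast
  qed
  moreover have "(a * a + 5) mod p = ((a mod p) * (a mod p) + 5) mod p"
    by (metis mod_add_left_eq mod_mult_eq)
  ultimately have "(a * a + 5) mod p = 0" by auto
  then show ?thesis by auto
qed

text \<open>A determinant vanishing modulo p makes (a', b') a multiple of the nonzero vector (a, b).
  Since units are self-inverse here, the multiplier a' / a can be written a a', and b' / b as b
  b'.\<close>

lemma proportional_mod_prime:
  fixes p a b a' b' :: nat
  assumes p: "p = 2 \<or> p = 3" and "\<not> (p dvd a \<and> p dvd b)" and d: "p dvd b * a' + 5 * (b' * a)"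
  obtains m where "(m * a) mod p = a' mod p" "(m * b) mod p = b' mod p"
proof -
  have p30: "p dvd 30 * x" for x using p by auto
  consider "\<not> p dvd a" | "\<not> p dvd b" using assms(2) by blast
  then show ?thesis
  proof cases
    case 1
    have sq: "p dvd a * a + 5" by (rule dvd_square_add_5[OF p 1])
    have "a * a' * a + 5 * a' = (a * a + 5) * a'" by (simp add: algebra_simps)
    then have x: "p dvd a * a' * a + 5 * a'" using sq by simp
    \<comment> \<open>This is a times the determinant; the summand 30 b', divisible by p, avoids
      subtraction.\<close>
    have "(a * a' * b + 5 * b') + 5 * b' * (a * a + 5) = a * (b * a' + 5 * (b' * a)) + 30 * b'"
      by (simp add: algebra_simps)
    moreover have "p dvd a * (b * a' + 5 * (b' * a)) + 30 * b'" using d p30 by simp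
    ultimately have "p dvd (a * a' * b + 5 * b') + 5 * b' * (a * a + 5)" by metis
    then have y: "p dvd a * a' * b + 5 * b'" using sq by (simp only: dvd_add_left_iff dvd_mult)
    show ?thesis using that[of "a * a'"] mod_eq_of_dvd_add_5[OF p x] mod_eq_of_dvd_add_5[OF p y] .
  next
    case 2
    have sq: "p dvd b * b + 5" by (rule dvd_square_add_5[OF p 2])
    have "b * b' * b + 5 * b' = (b * b + 5) * b'" by (simp add: algebra_simps)
    then have x: "p dvd b * b' * b + 5 * b'" using sq by simp
    have "(b * b' * a + 5 * a') + (24 * (b * b' * a) + 5 * a' * (b * b + 5)) = 5 * b * (b * a' + 5 * (b' * a)) + 30 * a'"
      by (simp add: algebra_simps)
    moreover have "p dvd 5 * b * (b * a' + 5 * (b' * a)) + 30 * a'" using d p30 by simp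
    ultimately have "p dvd (b * b' * a + 5 * a') + (24 * (b * b' * a) + 5 * a' * (b * b + 5))" by metis
    moreover have "p dvd 24 * (b * b' * a)" using p by auto
    ultimately have y: "p dvd b * b' * a + 5 * a'" using sq by (simp only: dvd_add_left_iff dvd_mult dvd_add)
    show ?thesis using that[of "b * b'"] mod_eq_of_dvd_add_5[OF p y] mod_eq_of_dvd_add_5[OF p x] .
  qed
qed

lemma weyl_symplectic_unit:
  assumes A: "weyl a b c \<in> H6" "nondegenerate (weyl a b c)"
    and B: "weyl a' b' c' \<in> H6" "nondegenerate (weyl a' b' c')"
    and meet: "meet_in_center (weyl a b c) (weyl a' b' c')"
  shows "(b * a' + 5 * (b' * a)) mod 6 = 1 \<or> (b * a' + 5 * (b' * a)) mod 6 = 5"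
proof (rule ccontr)
  assume "\<not> ?thesis"
  moreover have "2 dvd d \<or> 3 dvd d" if "\<not> (d mod 6 = 1 \<or> d mod 6 = 5)" for d :: nat
  proof -
    have "r \<in> {0, 2, 3, 4}" if "r < 6" "r \<noteq> 1" "r \<noteq> 5" for r :: nat
      using that by auto
    then have "d mod 6 \<in> {0, 2, 3, 4}" using that by simp
    then have "2 dvd d mod 6 \<or> 3 dvd d mod 6" by auto
    then show ?thesis by (simp add: dvd_mod_iff)
  qed
  ultimately have "2 dvd b * a' + 5 * (b' * a) \<or> 3 dvd b * a' + 5 * (b' * a)" by blast
  then obtain p :: nat where p: "p = 2 \<or> p = 3" and d: "p dvd b * a' + 5 * (b' * a)" by blast
  define n where "n = 6 div p"
  have n: "n * p = 6" using p by (auto simp: n_def)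
  obtain m where m: "(m * a) mod p = a' mod p" "(m * b) mod p = b' mod p"
    using proportional_mod_prime[OF p _ d] nondegenerate_weyl[OF A(2) p] by blast
  let ?A = "weyl a b c" and ?B = "weyl a' b' c'"
  interpret G: group GL6 by (rule group_GL6)
  have subgroup: "subgroup H6 GL6" unfolding H6_def
    by (rule G.generate_is_subgroup) (simp add: X6_weyl Z6_weyl weyl_GL6)
  define P where "P = ?B ^\<^sub>m n"
  define Q where "Q = ?A ^\<^sub>m (n * m)"
  obtain c1 where P: "P = weyl (n * a') (n * b') c1" using weyl_pow P_def by blast
  obtain c2 where Q: "Q = weyl (n * m * a) (n * m * b) c2" using weyl_pow Q_def by blast
  have PH: "P \<in> H6" and QH: "Q \<in> H6"
    using A(1) B(1) unfolding P_def Q_def H6_def by (simp_all add: pow_generate)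
  have cyc: "P \<in> cyclic_subgroup ?B" "Q \<in> cyclic_subgroup ?A"
    unfolding P_def Q_def cyclic_subgroup_def by (simp_all add: pow_generate generate.incl)
  \<comment> \<open>P = B^n and Q = A^(n m) have the same exponents of X and Z modulo 6, because n p
    = 6 lifts the congruences modulo p. Their quotient C is therefore a phase, which the enlargement
    by the center allows for.\<close>
  define C where "C = inv\<^bsub>GL6\<^esub> Q * P"
  have "C \<in> H6" using subgroup.m_inv_closed[OF subgroup QH] PH by (simp add: C_def H6_mult)
  have zero: "(5 * (n * m * x) + n * x') mod 6 = 0" if "(m * x) mod p = x' mod p" for x x'
  proof -
    have "(5 * (m * x) + x') mod p = (5 * (m * x) + m * x) mod p"
      using that by (intro mod_add_cong) simp_all
    also have "\<dots> = 0" using p by auto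
    finally have "p dvd 5 * (m * x) + x'" by auto
    then have "n * p dvd n * (5 * (m * x) + x')" by simp
    then show ?thesis unfolding n by (simp add: algebra_simps)
  qed
  have "\<exists>c0. C = weyl 0 0 c0"
    unfolding C_def P Q inv_weyl weyl_mult
    by (intro exI weyl_cong) (simp_all add: zero[OF m(1)] zero[OF m(2)])
  then obtain c0 where C: "C = weyl 0 0 c0" by blast
  have central: "weyl 0 0 k \<in> center_H6" if "weyl 0 0 k \<in> H6" for k
  proof -
    have "weyl 0 0 k * M = M * weyl 0 0 k" if M: "M \<in> H6" for M
    proof -
      obtain x y z where "M = weyl x y z" using H6_weyl[OF M] .
      then show ?thesis by (simp add: weyl_commutes_iff)
    qed
    then show ?thesis using that by (simp add: center_H6_def)
  qed
  have "P = Q * C" 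
  proof -
    have "Q * C = (Q * inv\<^bsub>GL6\<^esub> Q) * P"
      unfolding C_def P Q inv_weyl by (simp add: assoc_mult_mat[OF weyl_carrier weyl_carrier weyl_carrier])
    also have "Q * inv\<^bsub>GL6\<^esub> Q = 1\<^sub>m 6" unfolding Q inv_weyl weyl_inverse ..
    finally show ?thesis by (simp add: P left_mult_one_mat[OF weyl_carrier])
  qed
  moreover have "C \<in> center_H6" using central \<open>C \<in> H6\<close> C by blast
  ultimately have "P \<in> cyclic_subgroup ?A <#>\<^bsub>GL6\<^esub> center_H6"
    using cyc(2) by (auto simp: set_mult_def GL6_simps)
  moreover have "P \<in> cyclic_subgroup ?B <#>\<^bsub>GL6\<^esub> center_H6"
  proof -
    have "weyl 0 0 0 \<in> H6" using generate.one[of GL6] by (simp add: H6_def weyl_0 GL6_simps)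
    then have "weyl 0 0 0 \<in> center_H6" by (rule central)
    moreover have "P = P * weyl 0 0 0" unfolding weyl_0 P by (simp add: right_mult_one_mat[OF weyl_carrier])
    ultimately show ?thesis using cyc(1) by (auto simp: set_mult_def GL6_simps)
  qed
  ultimately have "P \<in> center_H6" using meet by (auto simp: meet_in_center_def)
  \<comment> \<open>Commuting with X and Z forces both exponents of P to vanish modulo 6, that is,
    a' and b' to vanish modulo p.\<close>
  moreover have "X6 \<in> H6" "Z6 \<in> H6" by (simp_all add: H6_def generate.incl)
  ultimately have "P * X6 = X6 * P" "P * Z6 = Z6 * P" by (auto simp: center_H6_def)
  then have "(n * b') mod 6 = 0" "(n * a') mod 6 = 0"
    unfolding P X6_weyl Z6_weyl weyl_commutes_iff by simp_all
  then have "n * p dvd n * b'" "n * p dvd n * a'" unfolding n by (simp_all add: mod_eq_0_iff_dvd)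
  then have "p dvd b'" "p dvd a'" unfolding nat_mult_dvd_cancel_disj using n by auto
  then show False using nondegenerate_weyl[OF B(2) p] by blast
qed

lemma mod_6_unit_difference:
  fixes x y :: nat
  assumes "(x + 5 * y) mod 6 = 1 \<or> (x + 5 * y) mod 6 = 5"
  shows "x mod 6 = Suc y mod 6 \<or> y mod 6 = Suc x mod 6"
proof -
  define q where "q = (x + 5 * y) div 6"
  have "x + 5 * y = 6 * q + 1 \<or> x + 5 * y = 6 * q + 5"
    using assms unfolding q_def by (metis mult_div_mod_eq)
  then have "x + 6 * y = Suc y + 6 * q \<or> y + 6 * Suc q = Suc x + 6 * y" by auto
  then show ?thesis unfolding nat_mod_eq_iff by blast
qed

lemma weyl_Suc_phase: "weyl a b (Suc c) = omega6 \<cdot>\<^sub>m weyl a b c"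
  by (rule eq_matI) (auto simp: weyl_def)

lemma weyl_commutation:
  assumes "weyl a b c \<in> H6" "nondegenerate (weyl a b c)"
    and "weyl a' b' c' \<in> H6" "nondegenerate (weyl a' b' c')"
    and "meet_in_center (weyl a b c) (weyl a' b' c')"
  shows "weyl a b c * weyl a' b' c' = omega6 \<cdot>\<^sub>m (weyl a' b' c' * weyl a b c) \<or>
    weyl a' b' c' * weyl a b c = omega6 \<cdot>\<^sub>m (weyl a b c * weyl a' b' c')"
proof -
  have "(b * a') mod 6 = Suc (b' * a) mod 6 \<or> (b' * a) mod 6 = Suc (b * a') mod 6"
    using weyl_symplectic_unit[OF assms] mod_6_unit_difference by blast
  moreover have "(k + x) mod 6 = Suc (k + y) mod 6" if "x mod 6 = Suc y mod 6" for k x y :: nat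
    using that mod_add_cong[of k 6 k x "Suc y"] by simp
  moreover have AB: "weyl a b c * weyl a' b' c' = weyl (a + a') (b + b') (c + c' + b * a')"
    and BA: "weyl a' b' c' * weyl a b c = weyl (a + a') (b + b') (c + c' + b' * a)"
    unfolding weyl_mult by (simp_all add: add_ac)
  ultimately show ?thesis
    unfolding AB BA weyl_Suc_phase[symmetric] by (auto intro: weyl_cong)
qed

section \<open>Orthonormal frames and Fourier pairs\<close>

lemma cscalar_prod_sum:
  fixes v w :: "complex vec"
  assumes "w \<in> carrier_vec 6"
  shows "v \<bullet>c w = (\<Sum>i<6. v $ i * cnj (w $ i))"
  using assms by (auto simp: scalar_prod_def atLeast0LessThan)

lemma cscalar_prod_swap:
  fixes v w :: "complex vec"
  assumes "v \<in> carrier_vec 6" "w \<in> carrier_vec 6"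
  shows "w \<bullet>c v = cnj (v \<bullet>c w)"
  unfolding cscalar_prod_sum[OF assms(1)] cscalar_prod_sum[OF assms(2)] by (simp add: mult.commute)

lemma cscalar_prod_smult:
  fixes v w :: "complex vec"
  assumes "v \<in> carrier_vec 6" "w \<in> carrier_vec 6"
  shows "(k \<cdot>\<^sub>v v) \<bullet>c w = k * (v \<bullet>c w)" "v \<bullet>c (k \<cdot>\<^sub>v w) = cnj k * (v \<bullet>c w)"
  using assms by (simp_all add: cscalar_prod_sum sum_distrib_left mult_ac)

text \<open>A Weyl matrix permutes the coordinates by j to j + a modulo 6 and multiplies them by
  phases.\<close>

lemma weyl_isometry:
  assumes "v \<in> carrier_vec 6" "w \<in> carrier_vec 6"
  shows "(weyl a b c *\<^sub>v v) \<bullet>c (weyl a b c *\<^sub>v w) = v \<bullet>c w"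
proof -
  let ?f = "\<lambda>j. (j + a) mod 6"
  have "inj_on ?f {..<6}"
    by (intro inj_onI) (simp add: add.commute[of _ a] mod_add_left_cancel_nat)
  moreover have "?f ` {..<6} \<subseteq> {..<6}" by auto
  ultimately have bij: "bij_betw ?f {..<6} {..<6}" by (simp add: bij_betw_def endo_inj_surj)
  have entry: "(weyl a b c *\<^sub>v v) $ ?f j = omega6 ^ (c + b * j) * v $ j"
    if "j < 6" "v \<in> carrier_vec 6" for j v
  proof -
    have eq: "?f j = ?f k \<longleftrightarrow> k = j" if "k \<in> {0..<6}" for k
      using \<open>inj_on ?f {..<6}\<close> that \<open>j < 6\<close> by (auto dest: inj_onD)
    have "(weyl a b c *\<^sub>v v) $ ?f j = (\<Sum>k\<in>{0..<6}. (if ?f j = ?f k then omega6 ^ (c + b * k) else 0) * v $ k)"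
      using that by (simp add: weyl_def scalar_prod_def)
    also have "\<dots> = (\<Sum>k\<in>{0..<6}. if k = j then omega6 ^ (c + b * k) * v $ k else 0)"
      by (rule sum.cong) (simp_all only: eq if_distrib[of "\<lambda>z. z * _"] mult_zero_left)
    finally show ?thesis using that by simp
  qed
  have car: "weyl a b c *\<^sub>v w \<in> carrier_vec 6" using assms by (simp add: mult_mat_vec_carrier[OF weyl_carrier])
  have "(weyl a b c *\<^sub>v v) \<bullet>c (weyl a b c *\<^sub>v w)
      = (\<Sum>j<6. (weyl a b c *\<^sub>v v) $ ?f j * cnj ((weyl a b c *\<^sub>v w) $ ?f j))"
    unfolding cscalar_prod_sum[OF car] by (rule sum.reindex_bij_betw[OF bij, symmetric])
  also have "\<dots> = (\<Sum>j<6. v $ j * cnj (w $ j))"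
  proof (rule sum.cong)
    fix j :: nat assume "j \<in> {..<6}"
    then have "(weyl a b c *\<^sub>v v) $ ?f j * cnj ((weyl a b c *\<^sub>v w) $ ?f j) =
        v $ j * cnj (w $ j) * (omega6 ^ (c + b * j) * cnj (omega6 ^ (c + b * j)))"
      using assms by (simp add: entry mult_ac)
    also have "omega6 ^ (c + b * j) * cnj (omega6 ^ (c + b * j)) = 1"
      by (rule cnj_unit_mult) (simp add: norm_power cmod_omega6)
    finally show "(weyl a b c *\<^sub>v v) $ ?f j * cnj ((weyl a b c *\<^sub>v w) $ ?f j) = v $ j * cnj (w $ j)"
      by simp
  qed simp
  finally show ?thesis using assms(2) by (simp add: cscalar_prod_sum)
qed

lemma orthonormal_basis_carrier: "orthonormal_basis 6 S \<Longrightarrow> v \<in> S \<Longrightarrow> v \<in> carrier_vec 6"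
  using vectorspace.basis_def[OF vec_vs[where n = 6 and ?'a = complex], of S]
  by (auto simp: orthonormal_basis_def module_vec_simps)

lemma orthonormal_basis_self: "orthonormal_basis 6 S \<Longrightarrow> v \<in> S \<Longrightarrow> v \<bullet>c v = 1"
  by (simp add: orthonormal_basis_def)

text \<open>Expanding the second w of \<open>w \<bullet>c w\<close> in the basis shows that w has
  norm 0.\<close>

lemma orthonormal_basis_complete:
  assumes S: "orthonormal_basis 6 S" and w: "w \<in> carrier_vec 6" and orth: "\<forall>v\<in>S. w \<bullet>c v = 0"
  shows "w = 0\<^sub>v 6"
proof -
  interpret V: vec_space "TYPE(complex)" 6 .
  have basis: "V.basis S" using S by (simp add: orthonormal_basis_def)
  then have SV: "S \<subseteq> carrier_vec 6" and "w \<in> V.span S"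
    using w by (auto simp: V.basis_def)
  then obtain a F where F: "finite F" "F \<subseteq> S" "w = V.lincomb a F"
    unfolding V.span_def by auto
  have FV: "F \<subseteq> carrier_vec 6" using F SV by auto
  have "w \<bullet>c w = (\<Sum>i<6. w $ i * cnj (\<Sum>x\<in>F. a x * x $ i))"
    unfolding cscalar_prod_sum[OF w] using V.lincomb_index[OF _ FV, of _ a] F(3) by simp
  also have "\<dots> = (\<Sum>x\<in>F. cnj (a x) * (\<Sum>i<6. w $ i * cnj (x $ i)))"
    by (simp add: sum_distrib_left sum.swap[of _ F] mult_ac)
  also have "\<dots> = 0"
  proof (rule sum.neutral, rule ballI)
    fix x assume "x \<in> F"
    then have "w \<bullet>c x = 0" "x \<in> carrier_vec 6" using orth F FV by auto
    then show "cnj (a x) * (\<Sum>i<6. w $ i * cnj (x $ i)) = 0" by (simp add: cscalar_prod_sum)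
  qed
  finally show ?thesis using w by simp
qed

text \<open>Indexed, unlike \<open>orthonormal_basis\<close>, since shifts and Fourier transforms
  act on the index. That six such vectors span the space is contained in
  \<open>parseval\<close>.\<close>

definition orthonormal_frame :: "(nat \<Rightarrow> complex vec) \<Rightarrow> bool" where
  "orthonormal_frame s \<longleftrightarrow> (\<forall>j<6. s j \<in> carrier_vec 6) \<and>
     (\<forall>i<6. \<forall>j<6. s i \<bullet>c s j = (if i = j then 1 else 0))"

text \<open>Orthonormality is P Q = 1, where P has the frame vectors as rows and Q is its adjoint.
  For square matrices Q P = 1 follows, which is the resolution of the identity.\<close>

lemma parseval:
  assumes s: "orthonormal_frame s" and v: "v \<in> carrier_vec 6" "w \<in> carrier_vec 6"
  shows "v \<bullet>c w = (\<Sum>j<6. (v \<bullet>c s j) * cnj (w \<bullet>c s j))"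
proof -
  have sc: "s j \<in> carrier_vec 6" if "j < 6" for j using s that by (simp add: orthonormal_frame_def)
  define P where "P = Matrix.mat 6 6 (\<lambda>(j, i). s j $ i)"
  define Q where "Q = Matrix.mat 6 6 (\<lambda>(i, j). cnj (s j $ i))"
  have "P * Q = 1\<^sub>m 6"
  proof (rule eq_matI)
    fix i j assume "i < dim_row (1\<^sub>m 6 :: complex mat)" "j < dim_col (1\<^sub>m 6 :: complex mat)"
    then have ij: "i < 6" "j < 6" by auto
    then have "(P * Q) $$ (i, j) = s i \<bullet>c s j"
      by (simp add: P_def Q_def scalar_prod_def cscalar_prod_sum[OF sc] carrier_vecD[OF sc] atLeast0LessThan)
    then show "(P * Q) $$ (i, j) = 1\<^sub>m 6 $$ (i, j)" using s ij by (simp add: orthonormal_frame_def)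
  qed (simp_all add: P_def Q_def)
  then have QP: "Q * P = 1\<^sub>m 6"
    by (rule mat_mult_left_right_inverse[rotated 2]) (simp_all add: P_def Q_def)
  have resolution: "(\<Sum>j<6. cnj (s j $ i) * s j $ k) = (if i = k then 1 else 0)" if "i < 6" "k < 6" for i k
  proof -
    have "(Q * P) $$ (i, k) = (\<Sum>j<6. cnj (s j $ i) * s j $ k)"
      using that by (simp add: P_def Q_def scalar_prod_def atLeast0LessThan)
    then show ?thesis using that QP by simp
  qed
  have "(\<Sum>j<6. (v \<bullet>c s j) * cnj (w \<bullet>c s j)) =
      (\<Sum>j<6. \<Sum>i<6. \<Sum>k<6. v $ i * cnj (w $ k) * (cnj (s j $ i) * s j $ k))"
    by (rule sum.cong) (simp_all add: cscalar_prod_sum[OF sc] sum_product mult_ac)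
  also have "\<dots> = (\<Sum>i<6. \<Sum>j<6. \<Sum>k<6. v $ i * cnj (w $ k) * (cnj (s j $ i) * s j $ k))"
    by (rule sum.swap)
  also have "\<dots> = (\<Sum>i<6. \<Sum>k<6. \<Sum>j<6. v $ i * cnj (w $ k) * (cnj (s j $ i) * s j $ k))"
    by (intro sum.cong refl sum.swap)
  also have "\<dots> = (\<Sum>i<6. \<Sum>k<6. v $ i * cnj (w $ k) * (if i = k then 1 else 0))"
    by (intro sum.cong refl) (simp flip: sum_distrib_left add: resolution)
  also have "\<dots> = (\<Sum>i<6. v $ i * cnj (w $ i))"
    by (simp add: if_distrib cong: if_cong)
  finally show ?thesis using v by (simp add: cscalar_prod_sum)
qed

lemma frame_coordinates:
  assumes s: "orthonormal_frame s"
  obtains w where "w \<in> carrier_vec 6" "\<And>k. k < 6 \<Longrightarrow> w \<bullet>c s k = y k"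
proof
  have sc: "s j \<in> carrier_vec 6" if "j < 6" for j using s that by (simp add: orthonormal_frame_def)
  let ?w = "Matrix.vec 6 (\<lambda>i. \<Sum>j<6. y j * s j $ i)"
  show "?w \<in> carrier_vec 6" by simp
  fix k :: nat assume k: "k < 6"
  have "?w \<bullet>c s k = (\<Sum>i<6. \<Sum>j<6. y j * (s j $ i * cnj (s k $ i)))"
    by (simp add: cscalar_prod_sum[OF sc[OF k]] sum_distrib_right sum_distrib_left mult_ac)
  also have "\<dots> = (\<Sum>j<6. \<Sum>i<6. y j * (s j $ i * cnj (s k $ i)))" by (rule sum.swap)
  also have "\<dots> = (\<Sum>j<6. y j * (s j \<bullet>c s k))"
    by (simp add: cscalar_prod_sum[OF sc[OF k]] sum_distrib_left)
  also have "\<dots> = (\<Sum>j<6. y j * (if j = k then 1 else 0))"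
    using s k by (intro sum.cong) (simp_all add: orthonormal_frame_def)
  also have "\<dots> = y k" using k by (simp add: if_distrib cong: if_cong)
  finally show "?w \<bullet>c s k = y k" .
qed

text \<open>A preserves the product of the two vectors but also multiplies it by
  \<open>k * cnj l\<close>, which differs from 1 since |l| = 1 and k and l are different.\<close>

lemma eigenvectors_orthogonal:
  assumes v: "v \<in> carrier_vec 6" "w \<in> carrier_vec 6"
    and iso: "(A *\<^sub>v v) \<bullet>c (A *\<^sub>v w) = v \<bullet>c w"
    and A: "A *\<^sub>v v = k \<cdot>\<^sub>v v" "A *\<^sub>v w = l \<cdot>\<^sub>v w" and l: "cmod l = 1" and "k \<noteq> l"
  shows "v \<bullet>c w = 0"
proof (rule ccontr)
  assume nz: "v \<bullet>c w \<noteq> 0"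
  have "v \<bullet>c w = k * cnj l * (v \<bullet>c w)"
    using iso v unfolding A by (simp add: cscalar_prod_smult mult_ac)
  then have "k * cnj l = 1" using nz by simp
  then have "k * (l * cnj l) = l" by (metis mult.assoc mult.commute mult_1)
  then show False using cnj_unit_mult[OF l] \<open>k \<noteq> l\<close> by simp
qed

lemma isometry_eigenvalue_norm:
  assumes v: "v \<in> carrier_vec 6" "v \<bullet>c v = 1"
    and iso: "(A *\<^sub>v v) \<bullet>c (A *\<^sub>v v) = v \<bullet>c v" and A: "A *\<^sub>v v = k \<cdot>\<^sub>v v"
  shows "cmod k = 1"
proof -
  have "k * cnj k = 1" using iso v unfolding A by (simp add: cscalar_prod_smult mult.commute)
  then have "complex_of_real ((cmod k)\<^sup>2) = of_real 1" by (simp only: complex_norm_square of_real_1)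
  then have "(cmod k)\<^sup>2 = 1" using of_real_eq_iff by blast
  then show ?thesis by (simp add: power2_eq_1_iff) (use norm_ge_zero[of k] in linarith)
qed

lemma orthonormal_basis_nonempty: "orthonormal_basis 6 S \<Longrightarrow> S \<noteq> {}"
proof
  assume S: "orthonormal_basis 6 S" "S = {}"
  have "unit_vec 6 0 = (0\<^sub>v 6 :: complex vec)" by (rule orthonormal_basis_complete[OF S(1)]) (simp_all add: S(2))
  then have "unit_vec 6 0 $ 0 = (0\<^sub>v 6 :: complex vec) $ 0" by (rule arg_cong)
  then show False by simp
qed

lemma eigenbasis_eigenvectors:
  assumes "orthonormal_eigenbasis 6 A S" "v \<in> S"
  shows "v \<in> carrier_vec 6" "v \<bullet>c v = 1" "\<exists>k. A *\<^sub>v v = k \<cdot>\<^sub>v v"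
  using assms orthonormal_basis_carrier orthonormal_basis_self
  by (auto simp: orthonormal_eigenbasis_def eigenvector_def)

section \<open>Characters of Z/6 and the Fourier pair of two eigenbases\<close>

lemma sixth_root_cases:
  assumes "z ^ 6 = (1 :: complex)"
  obtains m where "m < 6" "z = omega6 ^ m"
proof -
  \<comment> \<open>The linear factors of z^2 - 1, z^2 - z + 1 and z^2 + z + 1, with the sixth roots
    of unity written linearly in omega6.\<close>
  have "(z - 1) * (z + 1) * ((z - omega6) * (z - (1 - omega6))) * ((z - (omega6 - 1)) * (z + omega6)) = z ^ 6 - 1"
  proof -
    have w: "omega6 * omega6 = omega6 - 1" using omega6_sq by (simp add: power2_eq_square)
    have "(z - omega6) * (z - (1 - omega6)) = z * z - z + 1"
      "(z - (omega6 - 1)) * (z + omega6) = z * z + z + 1" by (simp_all add: algebra_simps w)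
    note factors = this
    show ?thesis unfolding factors by (simp add: algebra_simps eval_nat_numeral)
  qed
  then have "z = 1 \<or> z = - 1 \<or> z = omega6 \<or> z = 1 - omega6 \<or> z = omega6 - 1 \<or> z = - omega6"
    using assms by (auto simp: eq_neg_iff_add_eq_0)
  then show ?thesis
    using that[of 0] that[of 3] that[of 1] that[of 5] that[of 2] that[of 4]
    by (auto simp: omega6_powers omega6_cube omega6_sq)
qed

lemma omega6_orthogonality:
  assumes "m < 6" "n < 6" "m \<noteq> n"
  shows "(\<Sum>j<6. omega6 ^ (m * j) * cnj (omega6 ^ (n * j))) = 0"
proof -
  define z where "z = omega6 ^ m * cnj (omega6 ^ n)"
  have unit: "omega6 ^ n * cnj (omega6 ^ n) = 1" for n by (rule cnj_unit_mult) (simp add: norm_power cmod_omega6)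
  have "z ^ 6 = (omega6 ^ 6) ^ m * cnj ((omega6 ^ 6) ^ n)"
    by (simp add: z_def power_mult_distrib mult.commute flip: power_mult)
  then have "z ^ 6 = 1" by (simp add: omega6_pow6)
  moreover have "z \<noteq> 1"
  proof
    assume "z = 1"
    then have "omega6 ^ m * (omega6 ^ n * cnj (omega6 ^ n)) = omega6 ^ n" by (metis z_def mult.assoc mult.commute mult_1)
    then have "omega6 ^ m = omega6 ^ n" unfolding unit by simp
    then show False using assms by (simp only: omega6_power_eq_iff) simp
  qed
  ultimately have "(\<Sum>j<6. z ^ j) = 0" using geometric_sum[of z 6] by simp
  then show ?thesis by (simp add: z_def power_mult_distrib power_mult)
qed

text \<open>Up to phases, \<open>S\<close> consists of the frame \<open>s\<close> and \<open>T\<close> of its discrete Fourier transform.\<close>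

definition fourier_pair :: "(nat \<Rightarrow> complex vec) \<Rightarrow> complex vec set \<Rightarrow> complex vec set \<Rightarrow> bool" where
  "fourier_pair s S T \<longleftrightarrow> orthonormal_frame s \<and>
     (\<forall>v\<in>S. \<exists>j<6. \<forall>u\<in>carrier_vec 6. cmod (u \<bullet>c v) = cmod (u \<bullet>c s j)) \<and>
     (\<forall>j<6. \<exists>v\<in>S. \<forall>u\<in>carrier_vec 6. cmod (u \<bullet>c v) = cmod (u \<bullet>c s j)) \<and>
     (\<forall>t\<in>T. \<exists>m<6. \<exists>c. (cmod c)\<^sup>2 = 1 / 6 \<and> (\<forall>j<6. t \<bullet>c s j = c * omega6 ^ (m * j))) \<and>
     (\<forall>m<6. \<exists>t\<in>T. \<exists>c. (cmod c)\<^sup>2 = 1 / 6 \<and> (\<forall>j<6. t \<bullet>c s j = c * omega6 ^ (m * j)))"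

text \<open>The frame is generated from one eigenvector of A by B / \<mu>, where \<mu> is an
  eigenvalue of B. All eigenvalues of B have the same sixth power, so with this normalization the
  successive coordinates of an eigenvector of B differ by a factor that is a sixth root of
  unity.\<close>

lemma fourier_pair_of_commutation:
  assumes A: "A \<in> carrier_mat 6 6" and B: "B \<in> carrier_mat 6 6"
    and isoA: "\<And>v w. v \<in> carrier_vec 6 \<Longrightarrow> w \<in> carrier_vec 6 \<Longrightarrow> (A *\<^sub>v v) \<bullet>c (A *\<^sub>v w) = v \<bullet>c w"
    and isoB: "\<And>v w. v \<in> carrier_vec 6 \<Longrightarrow> w \<in> carrier_vec 6 \<Longrightarrow> (B *\<^sub>v v) \<bullet>c (B *\<^sub>v w) = v \<bullet>c w"
    and comm: "A * B = omega6 \<cdot>\<^sub>m (B * A)" and B6: "B ^\<^sub>m 6 = \<beta> \<cdot>\<^sub>m 1\<^sub>m 6"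
    and S: "orthonormal_eigenbasis 6 A S" and T: "orthonormal_eigenbasis 6 B T"
  shows "\<exists>s. fourier_pair s S T"
proof -
  have onS: "orthonormal_basis 6 S" and onT: "orthonormal_basis 6 T"
    using S T by (simp_all add: orthonormal_eigenbasis_def)
  obtain s0 \<alpha> where s0: "s0 \<in> carrier_vec 6" "s0 \<bullet>c s0 = 1" "A *\<^sub>v s0 = \<alpha> \<cdot>\<^sub>v s0"
    using orthonormal_basis_nonempty[OF onS] eigenbasis_eigenvectors[OF S] by blast
  have \<alpha>: "cmod \<alpha> = 1" by (rule isometry_eigenvalue_norm[OF s0(1,2) isoA[OF s0(1,1)] s0(3)])
  have evB: "\<exists>k. B *\<^sub>v t = k \<cdot>\<^sub>v t \<and> cmod k = 1 \<and> k ^ 6 = \<beta>" if t: "t \<in> T" for t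
  proof -
    note tc = eigenbasis_eigenvectors[OF T t]
    obtain k where k: "B *\<^sub>v t = k \<cdot>\<^sub>v t" using tc(3) by blast
    have "t \<noteq> 0\<^sub>v 6" using tc(2) by auto
    then have "eigenvector B t k" using tc B k by (auto simp: eigenvector_def)
    from eigenvector_pow[OF B this, of 6] have "\<beta> \<cdot>\<^sub>v t = k ^ 6 \<cdot>\<^sub>v t"
      unfolding B6 using tc(1) by (simp add: smult_mat_mult_vec[OF one_carrier_mat])
    then have "(\<beta> \<cdot>\<^sub>v t) \<bullet>c t = (k ^ 6 \<cdot>\<^sub>v t) \<bullet>c t" by simp
    then have "k ^ 6 = \<beta>" using tc by (simp add: cscalar_prod_smult)
    moreover have "cmod k = 1" by (rule isometry_eigenvalue_norm[OF tc(1,2) isoB[OF tc(1,1)] k])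
    ultimately show ?thesis using k by blast
  qed
  obtain \<mu> where \<mu>: "cmod \<mu> = 1" "\<mu> ^ 6 = \<beta>" using orthonormal_basis_nonempty[OF onT] evB by blast
  then have \<mu>0: "\<mu> \<noteq> 0" by auto
  define s where "s = (\<lambda>j. ((\<lambda>v. (1 / \<mu>) \<cdot>\<^sub>v (B *\<^sub>v v)) ^^ j) s0)"
  have s_0: "s 0 = s0" and s_Suc: "s (Suc j) = (1 / \<mu>) \<cdot>\<^sub>v (B *\<^sub>v s j)" for j
    by (simp_all add: s_def)
  have sc: "s j \<in> carrier_vec 6" for j
    by (induction j) (use s0 B in \<open>auto simp: s_0 s_Suc\<close>)
  have Bs: "B *\<^sub>v s j = \<mu> \<cdot>\<^sub>v s (Suc j)" for j
    using \<mu>0 by (simp add: s_Suc smult_smult_assoc)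
  have s_norm: "s j \<bullet>c s j = 1" for j
  proof (induction j)
    case (Suc j)
    have "\<mu> * (cnj \<mu> * (s (Suc j) \<bullet>c s (Suc j))) = (B *\<^sub>v s j) \<bullet>c (B *\<^sub>v s j)"
      unfolding Bs using sc by (simp add: cscalar_prod_smult)
    also have "\<dots> = 1" using isoB[OF sc sc] Suc by simp
    finally show ?case using cnj_unit_mult[OF \<mu>(1)] by (simp add: mult.assoc[symmetric])
  qed (simp add: s_0 s0)
  have As: "A *\<^sub>v s j = (\<alpha> * omega6 ^ j) \<cdot>\<^sub>v s j" for j
  proof (induction j)
    case (Suc j)
    have "A *\<^sub>v s (Suc j) = (1 / \<mu>) \<cdot>\<^sub>v (A *\<^sub>v (B *\<^sub>v s j))"
      unfolding s_Suc using A B sc by (simp add: mult_mat_vec)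
    also have "A *\<^sub>v (B *\<^sub>v s j) = (A * B) *\<^sub>v s j"
      by (rule assoc_mult_mat_vec[OF A B sc, symmetric])
    also have "\<dots> = omega6 \<cdot>\<^sub>v ((B * A) *\<^sub>v s j)"
      unfolding comm using A B sc by (intro smult_mat_mult_vec) auto
    also have "(B * A) *\<^sub>v s j = B *\<^sub>v (A *\<^sub>v s j)"
      by (rule assoc_mult_mat_vec[OF B A sc])
    also have "\<dots> = (\<alpha> * omega6 ^ j) \<cdot>\<^sub>v (B *\<^sub>v s j)"
      unfolding Suc.IH using B sc by (simp add: mult_mat_vec)
    finally show ?case unfolding s_Suc by (simp add: smult_smult_assoc mult_ac)
  qed (simp add: s_0 s0)
  have ev_norm: "cmod (\<alpha> * omega6 ^ j) = 1" for j by (simp add: norm_mult norm_power \<alpha> cmod_omega6)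
  have ev_eq: "\<alpha> * omega6 ^ i = \<alpha> * omega6 ^ j \<longleftrightarrow> i = j" if "i < 6" "j < 6" for i j
    using that \<alpha> by (auto simp: omega6_power_eq_iff)
  have orth: "s i \<bullet>c s j = 0" if "i < 6" "j < 6" "i \<noteq> j" for i j
    by (rule eigenvectors_orthogonal[OF sc sc isoA[OF sc sc] As As ev_norm]) (use that ev_eq in simp)
  have frame: "orthonormal_frame s"
    using sc s_norm orth by (auto simp: orthonormal_frame_def)
  have S_index: "\<exists>j<6. \<forall>u\<in>carrier_vec 6. cmod (u \<bullet>c v) = cmod (u \<bullet>c s j)" if v: "v \<in> S" for v
  proof -
    note vc = eigenbasis_eigenvectors[OF S v]
    obtain k where k: "A *\<^sub>v v = k \<cdot>\<^sub>v v" using vc(3) by blast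
    have "(\<Sum>j<6. (v \<bullet>c s j) * cnj (v \<bullet>c s j)) = 1" using parseval[OF frame vc(1,1)] vc(2) by simp
    then have "\<exists>j<6. v \<bullet>c s j \<noteq> 0"
      by (metis (no_types, lifting) lessThan_iff mult_zero_left sum.neutral zero_neq_one)
    then obtain j where j: "j < 6" "v \<bullet>c s j \<noteq> 0" by blast
    then have kj: "k = \<alpha> * omega6 ^ j"
      using eigenvectors_orthogonal[OF vc(1) sc isoA[OF vc(1) sc] k As ev_norm] by blast
    have z: "v \<bullet>c s i = 0" if "i < 6" "i \<noteq> j" for i
      by (rule eigenvectors_orthogonal[OF vc(1) sc isoA[OF vc(1) sc] k As ev_norm])
        (use kj ev_eq[of j i] that j in auto)
    \<comment> \<open>As an eigenvector of A, v is orthogonal to every frame vector with another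
      eigenvalue. A single term of the Parseval sum survives, so v is s_j up to a phase.\<close>
    have collapse: "u \<bullet>c v = (u \<bullet>c s j) * cnj (v \<bullet>c s j)" if "u \<in> carrier_vec 6" for u
    proof -
      have "u \<bullet>c v = (\<Sum>i<6. (u \<bullet>c s i) * cnj (v \<bullet>c s i))" by (rule parseval[OF frame that vc(1)])
      also have "\<dots> = (\<Sum>i<6. if i = j then (u \<bullet>c s j) * cnj (v \<bullet>c s j) else 0)"
        by (intro sum.cong) (simp_all add: z)
      finally show ?thesis using j(1) by simp
    qed
    have "(cmod (v \<bullet>c s j))\<^sup>2 = 1"
    proof -
      have "complex_of_real ((cmod (v \<bullet>c s j))\<^sup>2) = of_real 1"
        unfolding complex_norm_square using collapse[OF vc(1)] vc(2) by simp
      then show ?thesis using of_real_eq_iff by blast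
    qed
    then have "cmod (v \<bullet>c s j) = 1" by (simp add: power2_eq_1_iff) (use norm_ge_zero[of "v \<bullet>c s j"] in linarith)
    then show ?thesis using j(1) collapse by (auto simp: norm_mult)
  qed
  have S_cover: "\<exists>v\<in>S. \<forall>u\<in>carrier_vec 6. cmod (u \<bullet>c v) = cmod (u \<bullet>c s j)" if j: "j < 6" for j
  proof -
    have "s j \<noteq> 0\<^sub>v 6" using s_norm[of j] by auto
    then obtain v where v: "v \<in> S" "s j \<bullet>c v \<noteq> 0"
      using orthonormal_basis_complete[OF onS sc] by blast
    obtain i where i: "i < 6" "\<forall>u\<in>carrier_vec 6. cmod (u \<bullet>c v) = cmod (u \<bullet>c s i)"
      using S_index[OF v(1)] by blast
    \<comment> \<open>Otherwise s_j would be orthogonal to s_i and hence to v.\<close>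
    have "i = j" using i v(2) sc orth[OF j i(1)] by (metis norm_eq_zero)
    then show ?thesis using i v(1) by blast
  qed
  have T_index: "\<exists>m<6. \<exists>c. (cmod c)\<^sup>2 = 1 / 6 \<and> (\<forall>j<6. t \<bullet>c s j = c * omega6 ^ (m * j))" if t: "t \<in> T" for t
  proof -
    note tc = eigenbasis_eigenvectors[OF T t]
    obtain k where k: "B *\<^sub>v t = k \<cdot>\<^sub>v t" "cmod k = 1" "k ^ 6 = \<beta>" using evB[OF t] by blast
    have step: "t \<bullet>c s (Suc j) = cnj k * \<mu> * (t \<bullet>c s j)" for j
    proof -
      have "t \<bullet>c s j = k * (cnj \<mu> * (t \<bullet>c s (Suc j)))"
        using isoB[OF tc(1) sc[of j]] tc(1) sc unfolding Bs k(1) by (simp add: cscalar_prod_smult mult_ac)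
      then have "cnj k * \<mu> * (t \<bullet>c s j) = (k * cnj k) * (\<mu> * cnj \<mu>) * (t \<bullet>c s (Suc j))"
        by (simp add: mult_ac)
      then show ?thesis using cnj_unit_mult[OF k(2)] cnj_unit_mult[OF \<mu>(1)] by simp
    qed
    have "(cnj k * \<mu>) ^ 6 = cnj (k ^ 6) * \<mu> ^ 6" by (simp add: power_mult_distrib)
    also have "\<dots> = cnj (\<mu> ^ 6) * \<mu> ^ 6" by (simp only: k(3) \<mu>(2))
    also have "\<dots> = 1" using cnj_unit_mult[of "\<mu> ^ 6"] \<mu>(1) by (simp add: norm_power mult.commute)
    finally obtain m where m: "m < 6" "cnj k * \<mu> = omega6 ^ m" using sixth_root_cases by blast
    have form: "t \<bullet>c s j = (t \<bullet>c s 0) * omega6 ^ (m * j)" for j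
    proof (induction j)
      case (Suc j)
      have "t \<bullet>c s (Suc j) = omega6 ^ m * (t \<bullet>c s j)" using step m(2) by simp
      also have "\<dots> = omega6 ^ m * ((t \<bullet>c s 0) * omega6 ^ (m * j))" using Suc by (rule arg_cong)
      also have "\<dots> = (t \<bullet>c s 0) * (omega6 ^ m * omega6 ^ (m * j))" by (rule mult.left_commute)
      also have "omega6 ^ m * omega6 ^ (m * j) = omega6 ^ (m * Suc j)" by (simp flip: power_add)
      finally show ?case .
    qed simp
    have "complex_of_real (6 * (cmod (t \<bullet>c s 0))\<^sup>2) = of_real 1"
    proof -
      have "1 = (\<Sum>j<6. (t \<bullet>c s j) * cnj (t \<bullet>c s j))" using parseval[OF frame tc(1,1)] tc(2) by simp
      also have "\<dots> = (\<Sum>j<6::nat. (t \<bullet>c s 0) * cnj (t \<bullet>c s 0))"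
      proof (rule sum.cong)
        fix j :: nat
        have "omega6 ^ (m * j) * cnj (omega6 ^ (m * j)) = 1"
          by (rule cnj_unit_mult) (simp add: norm_power cmod_omega6)
        moreover have "(t \<bullet>c s j) * cnj (t \<bullet>c s j) =
            (t \<bullet>c s 0) * cnj (t \<bullet>c s 0) * (omega6 ^ (m * j) * cnj (omega6 ^ (m * j)))"
          by (simp add: form[of j] mult_ac)
        ultimately show "(t \<bullet>c s j) * cnj (t \<bullet>c s j) = (t \<bullet>c s 0) * cnj (t \<bullet>c s 0)" by simp
      qed simp
      finally show ?thesis by (simp only: of_real_mult complex_norm_square) simp
    qed
    then have "6 * (cmod (t \<bullet>c s 0))\<^sup>2 = 1" using of_real_eq_iff by blast
    then have "(cmod (t \<bullet>c s 0))\<^sup>2 = 1 / 6" by simp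
    then show ?thesis using m(1) form by blast
  qed
  have T_cover: "\<exists>t\<in>T. \<exists>c. (cmod c)\<^sup>2 = 1 / 6 \<and> (\<forall>j<6. t \<bullet>c s j = c * omega6 ^ (m * j))" if m: "m < 6" for m
  proof -
    \<comment> \<open>The coordinates of w are the m-th character, so w is orthogonal to every
      member of T that belongs to another character. As T is complete, some member must belong to
      this one.\<close>
    obtain w where w: "w \<in> carrier_vec 6" "\<And>j. j < 6 \<Longrightarrow> w \<bullet>c s j = omega6 ^ (m * j)"
      by (rule frame_coordinates[OF frame, of "\<lambda>j. omega6 ^ (m * j)"]) blast
    have "w \<bullet>c s 0 \<noteq> 0" using w(2)[of 0] by simp
    then have "w \<noteq> 0\<^sub>v 6" using sc[of 0] by (auto simp: cscalar_prod_sum)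
    then obtain t where t: "t \<in> T" "w \<bullet>c t \<noteq> 0"
      using orthonormal_basis_complete[OF onT w(1)] by blast
    obtain n c where n: "n < 6" "(cmod c)\<^sup>2 = 1 / 6" "\<forall>j<6. t \<bullet>c s j = c * omega6 ^ (n * j)"
      using T_index[OF t(1)] by blast
    have "w \<bullet>c t = (\<Sum>j<6. (w \<bullet>c s j) * cnj (t \<bullet>c s j))"
      by (rule parseval[OF frame w(1) eigenbasis_eigenvectors(1)[OF T t(1)]])
    also have "\<dots> = cnj c * (\<Sum>j<6. omega6 ^ (m * j) * cnj (omega6 ^ (n * j)))"
      unfolding sum_distrib_left using n(3) by (intro sum.cong) (simp_all add: w(2) mult_ac)
    finally have "m = n" using t(2) omega6_orthogonality[OF m n(1)] by auto
    then show ?thesis using t(1) n by blast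
  qed
  show ?thesis unfolding fourier_pair_def using frame S_index S_cover T_index T_cover by blast
qed

section \<open>Mutually unbiased bases\<close>

lemma fourier_pair_unbiased:
  assumes fp: "fourier_pair s S T" and "orthonormal_basis 6 S" "orthonormal_basis 6 T"
  shows "mutually_unbiased 6 S T"
proof -
  have "(cmod (v \<bullet>c t))\<^sup>2 = 1 / 6" if v: "v \<in> S" and t: "t \<in> T" for v t
  proof -
    have c: "v \<in> carrier_vec 6" "t \<in> carrier_vec 6" using assms v t orthonormal_basis_carrier by auto
    obtain j where j: "j < 6" "\<forall>u\<in>carrier_vec 6. cmod (u \<bullet>c v) = cmod (u \<bullet>c s j)"
      using fp v unfolding fourier_pair_def by blast
    obtain m c where m: "(cmod c)\<^sup>2 = 1 / 6" "\<forall>j<6. t \<bullet>c s j = c * omega6 ^ (m * j)"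
      using fp t unfolding fourier_pair_def by blast
    have "cmod (v \<bullet>c t) = cmod (t \<bullet>c v)" using cscalar_prod_swap[OF c] by simp
    also have "\<dots> = cmod (t \<bullet>c s j)" using j(2) c by blast
    also have "\<dots> = cmod c" using m(2) j(1) by (simp add: norm_mult norm_power cmod_omega6)
    finally show ?thesis using m(1) by simp
  qed
  then show ?thesis using assms by (simp add: mutually_unbiased_def)
qed

lemma unbiased_vector_biunimodular:
  assumes fp: "fourier_pair s S T" and S: "mutually_unbiased 6 U S" and T: "mutually_unbiased 6 U T"
    and u: "u \<in> U"
  shows "biunimodular (\<lambda>j. sqrt 6 * (u \<bullet>c s j))"
proof -
  have uc: "u \<in> carrier_vec 6" using S u orthonormal_basis_carrier by (auto simp: mutually_unbiased_def)
  have frame: "orthonormal_frame s" using fp by (simp add: fourier_pair_def)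
  have "cmod (sqrt 6 * (u \<bullet>c s j)) = 1" if j: "j < 6" for j
  proof -
    obtain v where v: "v \<in> S" "\<forall>u\<in>carrier_vec 6. cmod (u \<bullet>c v) = cmod (u \<bullet>c s j)"
      using fp j unfolding fourier_pair_def by blast
    have "(cmod (u \<bullet>c v))\<^sup>2 = 1 / 6" using S u v(1) by (simp add: mutually_unbiased_def)
    then have "(cmod (sqrt 6 * (u \<bullet>c s j)))\<^sup>2 = 1" using v(2) uc by (simp add: norm_mult power_mult_distrib)
    then show ?thesis
      by (simp only: power2_eq_1_iff) (use norm_ge_zero[of "sqrt 6 * (u \<bullet>c s j)"] in linarith)
  qed
  moreover have "(cmod (\<Sum>j<6. sqrt 6 * (u \<bullet>c s j) * cnj (omega6 ^ (k * j))))\<^sup>2 = 6" if k: "k < 6" for k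
  proof -
    have "\<forall>m<6. \<exists>t\<in>T. \<exists>c. (cmod c)\<^sup>2 = 1 / 6 \<and> (\<forall>j<6. t \<bullet>c s j = c * omega6 ^ (m * j))"
      using fp unfolding fourier_pair_def by (elim conjE)
    from this[rule_format, OF k] obtain t c where t: "t \<in> T"
      and c: "(cmod c)\<^sup>2 = 1 / 6" "\<forall>j<6. t \<bullet>c s j = c * omega6 ^ (k * j)" by blast
    have tc: "t \<in> carrier_vec 6" using T t orthonormal_basis_carrier by (auto simp: mutually_unbiased_def)
    \<comment> \<open>By Parseval the product with t is a multiple of the k-th Fourier coefficient;
      the value 6 compensates for |c|^2 = 1 / 6.\<close>
    have "sqrt 6 * (u \<bullet>c t) = cnj c * (\<Sum>j<6. sqrt 6 * (u \<bullet>c s j) * cnj (omega6 ^ (k * j)))"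
      unfolding parseval[OF frame uc tc] sum_distrib_left
      by (intro sum.cong) (simp_all add: c(2) mult_ac)
    then have "(cmod (sqrt 6 * (u \<bullet>c t)))\<^sup>2 = (cmod c)\<^sup>2 * (cmod (\<Sum>j<6. sqrt 6 * (u \<bullet>c s j) * cnj (omega6 ^ (k * j))))\<^sup>2"
      by (simp only: norm_mult complex_mod_cnj power_mult_distrib)
    moreover have "(cmod (u \<bullet>c t))\<^sup>2 = 1 / 6" using T u t by (simp add: mutually_unbiased_def)
    then have "(cmod (sqrt 6 * (u \<bullet>c t)))\<^sup>2 = 1" by (simp add: norm_mult power_mult_distrib)
    ultimately show ?thesis using c(1) by simp
  qed
  ultimately show ?thesis by (simp add: biunimodular_def)
qed

text \<open>For a fixed d every odd coordinate is -i d times the even one with the same residue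
  modulo 3, so all these vectors lie in a subspace of dimension 3.\<close>

lemma product_vectors_incomplete:
  assumes frame: "orthonormal_frame s" and U: "orthonormal_basis 6 U" and d: "d \<in> {1, -1}"
    and prod: "\<forall>u\<in>U. product_vector d (\<lambda>j. sqrt 6 * (u \<bullet>c s j))"
  shows False
proof -
  \<comment> \<open>A vector orthogonal to that subspace: each pair of coordinates contributes a
    multiple of 1 + (i d)^2 = 0.\<close>
  define y :: "nat \<Rightarrow> complex" where "y = (\<lambda>j. if even j then 1 else \<i> * d)"
  obtain w where w: "w \<in> carrier_vec 6" "\<And>j. j < 6 \<Longrightarrow> w \<bullet>c s j = y j"
    by (rule frame_coordinates[OF frame, of y]) blast
  have "w \<bullet>c u = 0" if u: "u \<in> U" for u
  proof -
    obtain g e where x: "\<forall>j<6. sqrt 6 * (u \<bullet>c s j) = crt_vector d g e (\<lambda>_. 1) j"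
      using prod u unfolding product_vector_def by blast
    have "sqrt 6 * (w \<bullet>c u) = (\<Sum>j<6. y j * cnj (sqrt 6 * (u \<bullet>c s j)))"
      unfolding parseval[OF frame w(1) orthonormal_basis_carrier[OF U u]] sum_distrib_left
      by (intro sum.cong) (simp_all add: w(2) mult_ac)
    also have "\<dots> = (\<Sum>j<6. y j * cnj (crt_vector d g e (\<lambda>_. 1) j))"
      using x by (intro sum.cong) simp_all
    also have "\<dots> = 0"
      using d by (auto simp: lessThan_6 y_def crt_vector_def algebra_simps)
    finally show ?thesis by simp
  qed
  then have "w = 0\<^sub>v 6" using orthonormal_basis_complete[OF U w(1)] by blast
  moreover have "w \<bullet>c s 0 = 1" using w(2)[of 0] by (simp add: y_def)
  moreover have "s 0 \<in> carrier_vec 6" using frame by (simp add: orthonormal_frame_def)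
  ultimately show False by (simp add: cscalar_prod_sum)
qed

text \<open>A single skew vector in one basis forces the whole other basis to consist of product
  vectors with its sign, by \<open>unlike\<close>. A skew vector always exists: if an arbitrary
  member of V is a product vector, then a member of U is skew.\<close>

lemma no_two_further_unbiased_bases:
  assumes fp: "fourier_pair s S T"
    and U: "mutually_unbiased 6 U S" "mutually_unbiased 6 U T"
    and V: "mutually_unbiased 6 V S" "mutually_unbiased 6 V T"
    and UV: "mutually_unbiased 6 U V"
  shows False
proof -
  define x where "x = (\<lambda>u j. sqrt 6 * (u \<bullet>c s j))"
  have frame: "orthonormal_frame s" using fp by (simp add: fourier_pair_def)
  have on: "orthonormal_basis 6 U" "orthonormal_basis 6 V" using UV by (simp_all add: mutually_unbiased_def)
  have types: "\<exists>d\<in>{1, -1}. product_vector d (x u) \<or> skew_vector d (x u)" if "u \<in> U \<union> V" for u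
    using that biunimodular_cases unbiased_vector_biunimodular[OF fp U] unbiased_vector_biunimodular[OF fp V]
    unfolding x_def by blast
  have overlap: "(cmod (\<Sum>j<6. x u j * cnj (x v j)))\<^sup>2 = 6" if u: "u \<in> U" and v: "v \<in> V" for u v
  proof -
    have c: "u \<in> carrier_vec 6" "v \<in> carrier_vec 6" using on u v orthonormal_basis_carrier by auto
    have "(\<Sum>j<6. x u j * cnj (x v j)) = complex_of_real (sqrt 6 * sqrt 6) * (u \<bullet>c v)"
      unfolding parseval[OF frame c] x_def sum_distrib_left of_real_mult
      by (intro sum.cong) (simp_all add: mult_ac)
    also have "\<dots> = 6 * (u \<bullet>c v)" by simp
    finally have "(cmod (\<Sum>j<6. x u j * cnj (x v j)))\<^sup>2 = 36 * (cmod (u \<bullet>c v))\<^sup>2"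
      by (simp add: norm_mult power_mult_distrib)
    moreover have "(cmod (u \<bullet>c v))\<^sup>2 = 1 / 6" using UV u v by (simp add: mutually_unbiased_def)
    ultimately show ?thesis by simp
  qed
  have overlap': "(cmod (\<Sum>j<6. x v j * cnj (x u j)))\<^sup>2 = 6" if "u \<in> U" "v \<in> V" for u v
  proof -
    have "(\<Sum>j<6. x v j * cnj (x u j)) = cnj (\<Sum>j<6. x u j * cnj (x v j))" by (simp add: mult.commute)
    then show ?thesis using overlap[OF that] by (simp only: complex_mod_cnj)
  qed
  obtain v d where v: "v \<in> V" "d \<in> {1, -1}" "product_vector d (x v) \<or> skew_vector d (x v)"
    using orthonormal_basis_nonempty[OF on(2)] types by blast
  have unlike: "product_vector d (x u)" if u: "u \<in> U \<union> V" and w: "skew_vector d (x w)"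
    and uw: "(cmod (\<Sum>j<6. x u j * cnj (x w j)))\<^sup>2 = 6" for u w
  proof -
    obtain d' where d': "d' \<in> {1, -1}" "product_vector d' (x u) \<or> skew_vector d' (x u)"
      using types[OF u] by blast
    then have "product_vector d' (x u)" using skew_skew_overlap[OF d'(1) v(2) _ w] uw by blast
    then show ?thesis using product_skew_overlap[OF d'(1) v(2) _ _ w] uw by blast
  qed
  from v(3) show False
  proof
    assume "skew_vector d (x v)"
    then have "\<forall>u\<in>U. product_vector d (x u)" using unlike overlap v(1) by blast
    then show False using product_vectors_incomplete[OF frame on(1) v(2)] unfolding x_def by blast
  next
    assume pv: "product_vector d (x v)"
    obtain u where u: "u \<in> U" using orthonormal_basis_nonempty[OF on(1)] by blast
    obtain d' where d': "d' \<in> {1, -1}" "product_vector d' (x u) \<or> skew_vector d' (x u)"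
      using types[of u] u by blast
    then have "skew_vector d' (x u)"
      using product_product_overlap[OF v(2) d'(1) pv] overlap'[OF u v(1)] by blast
    then have "skew_vector d (x u)"
      using product_skew_overlap[OF v(2) d'(1) _ pv] overlap'[OF u v(1)] by blast
    then have "\<forall>v\<in>V. product_vector d (x v)" using unlike overlap' u by blast
    then show False using product_vectors_incomplete[OF frame on(2) v(2)] unfolding x_def by blast
  qed
qed

text \<open>Removing S and T leaves at least two of the four bases, unbiased to S, to T and to each
  other.\<close>

lemma fourier_pair_not_in_four_mubs:
  assumes fp: "fourier_pair s S T"
  shows "\<not> (\<exists>\<B>. card \<B> = 4 \<and> mutually_unbiased_bases 6 \<B> \<and> S \<in> \<B> \<and> T \<in> \<B>)"
proof
  assume "\<exists>\<B>. card \<B> = 4 \<and> mutually_unbiased_bases 6 \<B> \<and> S \<in> \<B> \<and> T \<in> \<B>"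
  then obtain \<B> where B: "card \<B> = 4" "mutually_unbiased_bases 6 \<B>" "S \<in> \<B>" "T \<in> \<B>" by blast
  have "2 \<le> card (\<B> - {S, T})"
    using B(1) diff_card_le_card_Diff[of "{S, T}" \<B>] card_insert_le_m1[of 2 "{T}" S] by auto
  then obtain U V where UV: "U \<in> \<B> - {S, T}" "V \<in> \<B> - {S, T}" "U \<noteq> V"
    by (metis One_nat_def Suc_1 card_le_Suc0_iff_eq card.infinite not_less_eq_eq zero_le)
  have mu: "mutually_unbiased 6 P Q" if "P \<in> \<B>" "Q \<in> \<B>" "P \<noteq> Q" for P Q
    using B(2) that by (simp add: mutually_unbiased_bases_def)
  show False
    by (rule no_two_further_unbiased_bases[OF fp, of U V]) (use UV B mu in auto)
qed

lemma mutually_unbiased_swap: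
  assumes "mutually_unbiased 6 S T"
  shows "mutually_unbiased 6 T S"
proof -
  have on: "orthonormal_basis 6 S" "orthonormal_basis 6 T"
    and ub: "\<forall>v\<in>S. \<forall>w\<in>T. (cmod (v \<bullet>c w))\<^sup>2 = 1 / real 6"
    using assms unfolding mutually_unbiased_def by blast+
  have "cmod (w \<bullet>c v) = cmod (v \<bullet>c w)" if "v \<in> S" "w \<in> T" for v w
    using cscalar_prod_swap[of v w] on that orthonormal_basis_carrier by simp
  then show ?thesis using on ub unfolding mutually_unbiased_def by metis
qed

lemma weyl_pow_6: "\<exists>\<beta>. weyl a b c ^\<^sub>m 6 = \<beta> \<cdot>\<^sub>m 1\<^sub>m 6"
proof -
  obtain c' where "weyl a b c ^\<^sub>m 6 = weyl (6 * a) (6 * b) c'" using weyl_pow by blast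
  also have "\<dots> = weyl 0 0 c'" by (rule weyl_cong) simp_all
  finally show ?thesis unfolding weyl_scalar by blast
qed

lemma fourier_pair_of_weyl:
  assumes "weyl a b c * weyl a' b' c' = omega6 \<cdot>\<^sub>m (weyl a' b' c' * weyl a b c)"
    and "orthonormal_eigenbasis 6 (weyl a b c) S" "orthonormal_eigenbasis 6 (weyl a' b' c') T"
  shows "\<exists>s. fourier_pair s S T"
proof -
  obtain \<beta> where "weyl a' b' c' ^\<^sub>m 6 = \<beta> \<cdot>\<^sub>m 1\<^sub>m 6" using weyl_pow_6 by blast
  then show ?thesis
    using assms by (intro fourier_pair_of_commutation[OF weyl_carrier weyl_carrier weyl_isometry weyl_isometry])
qed

theorem mainTheorem4:
  fixes A B :: "complex mat" and S T :: "complex vec set"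
  assumes "A \<in> H6" and "B \<in> H6"
    and "nondegenerate A" and "nondegenerate B"
    and "meet_in_center A B"
    and "orthonormal_eigenbasis 6 A S" and "orthonormal_eigenbasis 6 B T"
  shows "mutually_unbiased 6 S T \<and>
    \<not> (\<exists>\<B>. card \<B> = 4 \<and> mutually_unbiased_bases 6 \<B> \<and> S \<in> \<B> \<and> T \<in> \<B>)"
proof -
  obtain a b c where A: "A = weyl a b c" using H6_weyl[OF assms(1)] .
  obtain a' b' c' where B: "B = weyl a' b' c'" using H6_weyl[OF assms(2)] .
  have on: "orthonormal_basis 6 S" "orthonormal_basis 6 T"
    using assms(6,7) by (simp_all add: orthonormal_eigenbasis_def)
  \<comment> \<open>The sign of the commutation phase decides which of A and B acts as the shift.
    \<open>fourier_pair\<close> distinguishes the two bases, whereas both claims are symmetric in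
    them.\<close>
  have "(\<exists>s. fourier_pair s S T) \<or> (\<exists>s. fourier_pair s T S)"
    using weyl_commutation[OF assms(1,3,2,4,5)[unfolded A B]] assms(6,7)
    unfolding A B by (metis fourier_pair_of_weyl)
  then show ?thesis
  proof (elim disjE exE)
    fix s assume fp: "fourier_pair s S T"
    show ?thesis
      using fourier_pair_unbiased[OF fp on] fourier_pair_not_in_four_mubs[OF fp] by (rule conjI)
  next
    fix s assume fp: "fourier_pair s T S"
    have "mutually_unbiased 6 S T" by (rule mutually_unbiased_swap[OF fourier_pair_unbiased[OF fp on(2,1)]])
    then show ?thesis using fourier_pair_not_in_four_mubs[OF fp] by blast
  qed
qed

end
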